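(* Let $H=(h_{i,j})$ be a (finite or infinite) unitary irreducible Hessenberg matrix and let us define $$\tau_n := \begin{cases} 1, & n=1,\\ \displaystyle\prod_{k=1}^{n-1} h_{k+1,k}, & n\ge 2.\end{cases}$$ Then $H$ is unitarily equivalent to a para-tridiagonal matrix $C=(c_{i,j})$ with the form $C=C(\mathbf a)$, $\mathbf a=(a_n)_{n\in\mathbb N}$ (if $H$ is infinite), or $C=C(\mathbf a_N)$, $\mathbf a_N=(a_1,\dots,a_N)$ (if $H$ has order $N$), where $$a_n=-\frac{h_{1,n}}{\overline{\tau}_n},\qquad n\ge1.$$ The unitary equivalence is given by $H=V^*CV$, where the columns of $V=(v_{i,j})$ can be recursively obtained by $$v_{i,j}=\begin{cases}\dfrac{\overline\tau_j}{|\tau_j|}\,\delta_{i,j}, & j=1,2,\\[2mm] \dfrac1{h_{j,j-1}}\left(\displaystyle\sum_{k=i-2}^{\min\{i+2,2j-4\}}c_{i,k}\,v_{k,j-1}-\sum_{k=\min\{i,[\frac{i+3}2]\}}^{j-1}h_{k,j-1}\,v_{i,k}\right), & i\le 2j-2,\ j\ge3,\\[2mm] 0, & i\ge 2j-1,\ j\ge3.\end{cases}$$ In this expression the sums have to be understood only over those terms in which the matrix coefficients have indices between $1$ and the order of $H$. The eigenvectors $x(\lambda)=\sum_n x_n(\lambda)e_n$ of $H$ and $y(\lambda)=\sum_n y_n(\lambda)e_n$ of $C$ corresponding to the same eigenvalue $\lambda$ are related by $$x_{2k-1}(\lambda)=\frac{\tau_{2k-1}}{|\tau_{2k-1}|}\lambda^{1-k}\,\overline{y_{2k-1}(\lambda)},\qquad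 x_{2k}(\lambda)=\frac{\tau_{2k}}{|\tau_{2k}|}\lambda^{1-k}\,y_{2k}(\lambda),\qquad k\ge1.$$
   Context: Infinite matrices are indexed by $\mathbb{N}=\{1,2,\dots\}$ and, if bounded, identified with operators on $\ell^2(\mathbb N)$; matrices of order $N$ are operators on $\mathbb C^N$. In both cases $\{e_n\}$ is the canonical basis, and for a matrix of order $N$ all indices run up to $N$. $[\cdot]$ denotes integer part and $\delta_{i,j}$ the Kronecker delta. A Hessenberg matrix $H=(h_{i,j})$ satisfies $h_{i,j}=0$ for $i>j+1$; it is irreducible if $h_{n+1,n}\neq0$ for all $n$. A para-tridiagonal matrix is a five-diagonal matrix ($c_{i,j}=0$ for $|i-j|>2$) with $c_{2k,2k+2}=c_{2k+1,2k-1}=0$ for all $k\ge1$. For a sequence $\mathbf a=(a_n)_{n\in\mathbb N}$ with $|a_n|\le1$, put $\rho_n=\sqrt{1-|a_n|^2}$ for $n\ge1$ and $a_0=1$. $C(\mathbf a)$ is the infinite matrix whose only possibly nonzero entries are, for $k\ge0$ (entries with column index $0$ being omitted): row $2k+1$: $c_{2k+1,2k}=-\rho_{2k}a_{2k+1}$, $c_{2k+1,2k+1}=-\overline a_{2k}a_{2k+1}$, $c_{2k+1,2k+2}=-\rho_{2k+1}a_{2k+2}$, $c_{2k+1,2k+3}=\rho_{2k+1}\rho_{2k+2}$; row $2k+2$: $c_{2k+2,2k}=\rho_{2k}\rho_{2k+1}$, $c_{2k+2,2k+1}=\overline a_{2k}\rho_{2k+1}$, $c_{2k+2,2k+2}=-\overline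 a_{2k+1}a_{2k+2}$, $c_{2k+2,2k+3}=\overline a_{2k+1}\rho_{2k+2}$. $C(\mathbf a_N)$ denotes the principal submatrix of order $N$ of $C(\mathbf a)$ (first $N$ rows and columns), which depends only on $\mathbf a_N=(a_1,\dots,a_N)$.
   Formalization: The eigenvector relation is stated for eigenvectors normalized so that their first components are equal and real (first components are proved nonzero); for arbitrary eigenvectors it fails, since it is conjugate-linear in odd and linear in even components. *)

theory Defs
  imports "HOL-Analysis.Analysis" "HOL-Library.Extended_Nat"
begin

text \<open>
  A matrix of order \<open>N\<close>, where \<open>N = \<infinity>\<close> is allowed, is represented by a function
  of two indices starting from 1. Only its entries with both indices in \<open>idx N\<close>
  are meaningful. So the restriction of an infinite matrix to its
  principal submatrix of order \<open>N\<close> needs no notation: it is the same function, read on \<open>idx N\<close>.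
\<close>

type_synonym cmat = "nat \<Rightarrow> nat \<Rightarrow> complex"
type_synonym cvec = "nat \<Rightarrow> complex"

definition idx :: "enat \<Rightarrow> nat set" where
  "idx N = {i. 1 \<le> i \<and> enat i \<le> N}"

text \<open>
  For \<open>N = \<infinity>\<close> this is the sequence space \<open>\<ell>\<^sup>2\<close>, and for finite \<open>N\<close> it is complex Euclidean
  \<open>N\<close>-space. Vectors vanish outside \<open>idx N\<close>, so that equal vectors are equal functions.
\<close>

definition ell2 :: "enat \<Rightarrow> cvec set" where
  "ell2 N = {x. (\<forall>i. i \<notin> idx N \<longrightarrow> x i = 0) \<and> (\<lambda>i. (cmod (x i))\<^sup>2) summable_on idx N}"

definition ell2_norm :: "enat \<Rightarrow> cvec \<Rightarrow> real" where
  "ell2_norm N x = sqrt (\<Sum>\<^sub>\<infinity>i\<in>idx N. (cmod (x i))\<^sup>2)"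

definition mat_app :: "enat \<Rightarrow> cmat \<Rightarrow> cvec \<Rightarrow> cvec" where
  "mat_app N A x = (\<lambda>i. if i \<in> idx N then \<Sum>\<^sub>\<infinity>j\<in>idx N. A i j * x j else 0)"

text \<open>
  Summability is required explicitly because an infinite sum that does not converge
  has the default value 0 in the library.
\<close>

definition bounded_matrix :: "enat \<Rightarrow> cmat \<Rightarrow> bool" where
  "bounded_matrix N A \<longleftrightarrow>
     (\<forall>x\<in>ell2 N. (\<forall>i\<in>idx N. (\<lambda>j. A i j * x j) summable_on idx N) \<and> mat_app N A x \<in> ell2 N) \<and>
     (\<exists>B. \<forall>x\<in>ell2 N. ell2_norm N (mat_app N A x) \<le> B * ell2_norm N x)"

definition mat_adj :: "cmat \<Rightarrow> cmat" where
  "mat_adj A = (\<lambda>i j. cnj (A j i))"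

definition unitary_matrix :: "enat \<Rightarrow> cmat \<Rightarrow> bool" where
  "unitary_matrix N A \<longleftrightarrow> bounded_matrix N A \<and> bounded_matrix N (mat_adj A) \<and>
     (\<forall>x\<in>ell2 N. mat_app N (mat_adj A) (mat_app N A x) = x \<and>
                 mat_app N A (mat_app N (mat_adj A) x) = x)"

text \<open>\<open>A = V\<^sup>* B V\<close> as operators, with \<open>V\<close> unitary.\<close>

definition unitarily_equivalent_via :: "enat \<Rightarrow> cmat \<Rightarrow> cmat \<Rightarrow> cmat \<Rightarrow> bool" where
  "unitarily_equivalent_via N V A B \<longleftrightarrow>
     bounded_matrix N A \<and> bounded_matrix N B \<and> unitary_matrix N V \<and>
     (\<forall>x\<in>ell2 N. mat_app N A x = mat_app N (mat_adj V) (mat_app N B (mat_app N V x)))"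

definition eigenvector :: "enat \<Rightarrow> cmat \<Rightarrow> complex \<Rightarrow> cvec \<Rightarrow> bool" where
  "eigenvector N A z x \<longleftrightarrow> x \<in> ell2 N \<and> x \<noteq> (\<lambda>i. 0) \<and> mat_app N A x = (\<lambda>i. z * x i)"

definition hessenberg :: "enat \<Rightarrow> cmat \<Rightarrow> bool" where
  "hessenberg N H \<longleftrightarrow> (\<forall>i\<in>idx N. \<forall>j\<in>idx N. i > j + 1 \<longrightarrow> H i j = 0)"

definition irreducible_hessenberg :: "enat \<Rightarrow> cmat \<Rightarrow> bool" where
  "irreducible_hessenberg N H \<longleftrightarrow>
     hessenberg N H \<and> (\<forall>n\<in>idx N. n + 1 \<in> idx N \<longrightarrow> H (n + 1) n \<noteq> 0)"

definition para_tridiagonal :: "enat \<Rightarrow> cmat \<Rightarrow> bool" where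
  "para_tridiagonal N C \<longleftrightarrow>
     (\<forall>i\<in>idx N. \<forall>j\<in>idx N. \<bar>int i - int j\<bar> > 2 \<longrightarrow> C i j = 0) \<and>
     (\<forall>k\<ge>1. (2*k + 2 \<in> idx N \<longrightarrow> C (2*k) (2*k + 2) = 0) \<and>
            (2*k + 1 \<in> idx N \<longrightarrow> C (2*k + 1) (2*k - 1) = 0))"

text \<open>The convention \<open>a\<^sub>0 = 1\<close>; the value of the function \<open>a\<close> at 0 is ignored.\<close>

definition ext0 :: "cvec \<Rightarrow> cvec" where
  "ext0 a n = (if n = 0 then 1 else a n)"

definition rho :: "cvec \<Rightarrow> nat \<Rightarrow> real" where
  "rho a n = sqrt (1 - (cmod (ext0 a n))\<^sup>2)"

text \<open>
  The matrix \<open>C(\<^bold>a)\<close>. In rows \<open>2k+1\<close> and \<open>2k+2\<close> we have \<open>m = 2k\<close>. For \<open>k = 0\<close> the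
  clause \<open>j = m\<close> concerns column 0, which is outside \<open>idx N\<close> and hence omitted.
\<close>

definition Cmat :: "cvec \<Rightarrow> cmat" where
  "Cmat a i j =
     (let m = 2 * ((i - 1) div 2) in
      if odd i then
        (if j = m then - of_real (rho a m) * ext0 a (m+1)
         else if j = m+1 then - cnj (ext0 a m) * ext0 a (m+1)
         else if j = m+2 then - of_real (rho a (m+1)) * ext0 a (m+2)
         else if j = m+3 then of_real (rho a (m+1)) * of_real (rho a (m+2))
         else 0)
      else
        (if j = m then of_real (rho a m) * of_real (rho a (m+1))
         else if j = m+1 then cnj (ext0 a m) * of_real (rho a (m+1))
         else if j = m+2 then - cnj (ext0 a (m+1)) * ext0 a (m+2)
         else if j = m+3 then cnj (ext0 a (m+1)) * of_real (rho a (m+2))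
         else 0))"

definition tau :: "cmat \<Rightarrow> nat \<Rightarrow> complex" where
  "tau H n = (if n = 1 then 1 else \<Prod>k=1..n-1. H (k+1) k)"

text \<open>
  The recursion for the columns of \<open>V\<close>. It determines \<open>V\<close> uniquely on \<open>idx N\<close>.
  The lower limit \<open>k \<ge> i - 2\<close> is written without subtraction, and \<open>div\<close> is the integer part.
\<close>

definition V_recursion :: "enat \<Rightarrow> cmat \<Rightarrow> cmat \<Rightarrow> cmat \<Rightarrow> bool" where
  "V_recursion N H C V \<longleftrightarrow>
     (\<forall>i\<in>idx N. \<forall>j\<in>idx N.
        V i j =
          (if j \<le> 2 then
             cnj (tau H j) / of_real (cmod (tau H j)) * (if i = j then 1 else 0)
           else if i \<le> 2*j - 2 then
             1 / H j (j-1) *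
               ((\<Sum>k | k \<in> idx N \<and> i \<le> k + 2 \<and> k \<le> min (i+2) (2*j-4). C i k * V k (j-1)) -
                (\<Sum>k | k \<in> idx N \<and> min i ((i+3) div 2) \<le> k \<and> k \<le> j-1. H k (j-1) * V i k))
           else 0))"

end

theory Submission
  imports Defs
begin

text \<open>
  Write \<open>U\<close> for the unitary operator \<open>H\<close>, and let \<open>\<phi>\<^bsub>n-1\<^esub>\<close> be \<open>e\<^sub>n\<close> multiplied by the phase of \<open>\<tau>\<^sub>n\<close>. The
  vector \<open>\<phi>\<^sup>*\<^bsub>n-1\<^esub>\<close> in the span of \<open>e\<^sub>1, \<dots>, e\<^sub>n\<close> orthogonal to \<open>U e\<^sub>1, \<dots>, U e\<^bsub>n-1\<^esub>\<close> is unique up to a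
  factor, because \<open>H\<close> is irreducible, and this yields the Szego recursion
  \<open>U \<phi>\<^bsub>n-1\<^esub> = \<rho>\<^sub>n \<phi>\<^sub>n - a\<^sub>n \<phi>\<^sup>*\<^bsub>n-1\<^esub>\<close>, \<open>\<phi>\<^sup>*\<^sub>n = cnj a\<^sub>n \<phi>\<^sub>n + \<rho>\<^sub>n \<phi>\<^sup>*\<^bsub>n-1\<^esub>\<close>.
  The vectors \<open>\<chi>\<^bsub>2k+1\<^esub> = U\<^sup>-\<^sup>k \<phi>\<^sup>*\<^bsub>2k\<^esub>\<close> and \<open>\<chi>\<^bsub>2k+2\<^esub> = U\<^sup>-\<^sup>k \<phi>\<^bsub>2k+1\<^esub>\<close> form an orthonormal basis in which
  \<open>U\<close> has the matrix \<open>C(\<^bold>a)\<close>, so that \<open>V\<close> is the matrix of the coordinates with respect to it. An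
  eigenvector of \<open>H\<close> is determined by its first entry, hence \<open>x = V\<^sup>* y\<close>, and the relation between the
  entries is \<open>y\<^sub>n = \<langle>\<chi>\<^sub>n, x\<rangle>\<close> combined with \<open>\<phi>\<^sup>*\<^sub>n(\<lambda>) = \<lambda>\<^sup>n cnj (\<phi>\<^sub>n(\<lambda>))\<close> for \<open>\<bar>\<lambda>\<bar> = 1\<close>.
\<close>

subsection \<open>The inner product of \<open>\<ell>\<^sup>2\<close>\<close>

definition ip :: "enat \<Rightarrow> cvec \<Rightarrow> cvec \<Rightarrow> complex" where
  "ip N x y = (\<Sum>\<^sub>\<infinity>i\<in>idx N. cnj (x i) * y i)"

definition unit_vec :: "nat \<Rightarrow> cvec" where
  "unit_vec k = (\<lambda>i. if i = k then 1 else 0)"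

lemma idx_down: "k \<in> idx N \<Longrightarrow> 1 \<le> j \<Longrightarrow> j \<le> k \<Longrightarrow> j \<in> idx N"
  unfolding idx_def by (auto intro: order_trans[of "enat j" "enat k"])

lemma one_in_idx: "N \<noteq> 0 \<Longrightarrow> 1 \<in> idx N"
  by (cases N) (auto simp: idx_def zero_enat_def)

lemma ell2_outside: "x \<in> ell2 N \<Longrightarrow> i \<notin> idx N \<Longrightarrow> x i = 0"
  by (simp add: ell2_def)

lemma ell2_summable: "x \<in> ell2 N \<Longrightarrow> (\<lambda>i. (cmod (x i))\<^sup>2) summable_on idx N"
  by (simp add: ell2_def)

lemma ell2_finite_support:
  assumes "\<And>i. i \<notin> idx N \<Longrightarrow> x i = 0" "finite F" "\<And>i. i \<notin> F \<Longrightarrow> x i = 0"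
  shows "x \<in> ell2 N"
proof -
  have "((\<lambda>i. (cmod (x i))\<^sup>2) has_sum (\<Sum>i\<in>F \<inter> idx N. (cmod (x i))\<^sup>2)) (idx N)"
    by (rule has_sum_finite_neutralI) (use assms in auto)
  then show ?thesis
    using assms(1) by (auto simp: ell2_def summable_on_def)
qed

lemma ell2_partial_sumsI:
  assumes "\<And>i. i \<notin> idx N \<Longrightarrow> x i = 0"
    and "\<And>K. finite K \<Longrightarrow> K \<subseteq> idx N \<Longrightarrow> (\<Sum>i\<in>K. (cmod (x i))\<^sup>2) \<le> M"
  shows "x \<in> ell2 N"
proof -
  have "(\<lambda>i. (cmod (x i))\<^sup>2) summable_on idx N"
    by (rule nonneg_bdd_above_summable_on) (use assms(2) in \<open>auto intro: bdd_aboveI2[where M = M]\<close>)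
  then show ?thesis
    using assms(1) by (simp add: ell2_def)
qed

lemma unit_vec_ell2: "k \<in> idx N \<Longrightarrow> unit_vec k \<in> ell2 N"
  by (rule ell2_finite_support[where F = "{k}"]) (auto simp: unit_vec_def)

lemma ell2_zero: "(\<lambda>i. 0) \<in> ell2 N"
  by (auto simp: ell2_def)

lemma ell2_add:
  assumes "x \<in> ell2 N" "y \<in> ell2 N"
  shows "(\<lambda>i. x i + y i) \<in> ell2 N"
proof -
  have "(cmod (x i + y i))\<^sup>2 \<le> 2 * (cmod (x i))\<^sup>2 + 2 * (cmod (y i))\<^sup>2" for i
  proof -
    have "(cmod (x i + y i))\<^sup>2 \<le> (cmod (x i) + cmod (y i))\<^sup>2"
      by (intro power_mono norm_triangle_ineq norm_ge_zero)
    also have "\<dots> \<le> 2 * (cmod (x i))\<^sup>2 + 2 * (cmod (y i))\<^sup>2"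
      using zero_le_power2[of "cmod (x i) - cmod (y i)"] by (simp add: power2_eq_square algebra_simps)
    finally show ?thesis .
  qed
  moreover have "(\<lambda>i. 2 * (cmod (x i))\<^sup>2 + 2 * (cmod (y i))\<^sup>2) summable_on idx N"
    using assms by (intro summable_on_add summable_on_cmult_right ell2_summable)
  ultimately have "(\<lambda>i. (cmod (x i + y i))\<^sup>2) summable_on idx N"
    by (metis (no_types, lifting) summable_on_comparison_test zero_le_power2)
  then show ?thesis
    using assms by (auto simp: ell2_def)
qed

lemma ell2_scale: "x \<in> ell2 N \<Longrightarrow> (\<lambda>i. c * x i) \<in> ell2 N"
  by (auto simp: ell2_def norm_mult power_mult_distrib intro!: summable_on_cmult_right)

lemma ell2_diff: "x \<in> ell2 N \<Longrightarrow> y \<in> ell2 N \<Longrightarrow> (\<lambda>i. x i - y i) \<in> ell2 N"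
  using ell2_add[OF _ ell2_scale[of y N "-1"], of x] by simp

lemma ell2_sum:
  assumes "finite K" "\<And>k. k \<in> K \<Longrightarrow> f k \<in> ell2 N"
  shows "(\<lambda>i. \<Sum>k\<in>K. c k * f k i) \<in> ell2 N"
  using assms by (induction K rule: finite_induct) (auto intro!: ell2_zero ell2_add ell2_scale)

lemma ell2_norm_nonneg: "0 \<le> ell2_norm N x"
  by (simp add: ell2_norm_def infsum_nonneg)

lemma ell2_norm_power2: "(ell2_norm N x)\<^sup>2 = (\<Sum>\<^sub>\<infinity>i\<in>idx N. (cmod (x i))\<^sup>2)"
  by (simp add: ell2_norm_def infsum_nonneg)

lemma L2_set_le_ell2_norm:
  assumes "x \<in> ell2 N" "finite F" "F \<subseteq> idx N"
  shows "L2_set (\<lambda>i. cmod (x i)) F \<le> ell2_norm N x"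
  unfolding L2_set_def ell2_norm_def
  by (intro real_sqrt_le_mono finite_sum_le_infsum ell2_summable assms) auto

lemma sum_ip_le:
  assumes "x \<in> ell2 N" "y \<in> ell2 N" "finite F" "F \<subseteq> idx N"
  shows "(\<Sum>i\<in>F. cmod (cnj (x i) * y i)) \<le> ell2_norm N x * ell2_norm N y"
proof -
  have "(\<Sum>i\<in>F. cmod (cnj (x i) * y i)) = (\<Sum>i\<in>F. \<bar>cmod (x i)\<bar> * \<bar>cmod (y i)\<bar>)"
    by (simp add: norm_mult)
  also have "\<dots> \<le> L2_set (\<lambda>i. cmod (x i)) F * L2_set (\<lambda>i. cmod (y i)) F"
    by (rule L2_set_mult_ineq)
  also have "\<dots> \<le> ell2_norm N x * ell2_norm N y"
    by (intro mult_mono L2_set_le_ell2_norm assms ell2_norm_nonneg L2_set_nonneg)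
  finally show ?thesis .
qed

lemma ip_abs_summable:
  assumes "x \<in> ell2 N" "y \<in> ell2 N"
  shows "(\<lambda>i. cmod (cnj (x i) * y i)) summable_on idx N"
  using sum_ip_le[OF assms]
  by (intro nonneg_bdd_above_summable_on bdd_aboveI2[where M = "ell2_norm N x * ell2_norm N y"]) auto

lemma ip_summable:
  "x \<in> ell2 N \<Longrightarrow> y \<in> ell2 N \<Longrightarrow> (\<lambda>i. cnj (x i) * y i) summable_on idx N"
  by (rule abs_summable_summable[OF ip_abs_summable])

lemma Cauchy_Schwarz_ip:
  assumes "x \<in> ell2 N" "y \<in> ell2 N"
  shows "cmod (ip N x y) \<le> ell2_norm N x * ell2_norm N y"
proof -
  have "cmod (ip N x y) \<le> (\<Sum>\<^sub>\<infinity>i\<in>idx N. cmod (cnj (x i) * y i))"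
    unfolding ip_def by (rule norm_infsum_bound[OF ip_abs_summable[OF assms]])
  also have "\<dots> \<le> ell2_norm N x * ell2_norm N y"
    by (rule infsum_le_finite_sums[OF ip_abs_summable[OF assms] sum_ip_le[OF assms]])
  finally show ?thesis .
qed

lemma ip_add:
  assumes "u \<in> ell2 N" "x \<in> ell2 N" "y \<in> ell2 N"
  shows "ip N u (\<lambda>i. x i + y i) = ip N u x + ip N u y"
  unfolding ip_def using infsum_add[OF ip_summable[OF assms(1,2)] ip_summable[OF assms(1,3)]]
  by (simp add: algebra_simps)

lemma ip_scale: "ip N u (\<lambda>i. c * x i) = c * ip N u x"
  unfolding ip_def infsum_cmult_right'[symmetric] by (simp add: mult_ac)

lemma ip_zero: "ip N u (\<lambda>i. 0) = 0"
  by (simp add: ip_def)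

lemma ip_commute: "ip N x y = cnj (ip N y x)"
  unfolding ip_def infsum_cnj[symmetric] by (simp add: mult_ac)

lemma ip_diff:
  assumes "u \<in> ell2 N" "x \<in> ell2 N" "y \<in> ell2 N"
  shows "ip N u (\<lambda>i. x i - y i) = ip N u x - ip N u y"
  using ip_add[OF assms(1,2) ell2_scale[OF assms(3), of "-1"]] ip_scale[of N u "-1" y] by simp

lemma ip_lincomb:
  assumes "u \<in> ell2 N" "x \<in> ell2 N" "y \<in> ell2 N"
  shows "ip N u (\<lambda>i. c * x i + d * y i) = c * ip N u x + d * ip N u y"
  by (simp add: ip_add[OF assms(1) ell2_scale[OF assms(2)] ell2_scale[OF assms(3)]] ip_scale)

lemma ip_lincomb_left:
  assumes "u \<in> ell2 N" "x \<in> ell2 N" "y \<in> ell2 N"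
  shows "ip N (\<lambda>i. c * x i + d * y i) u = cnj c * ip N x u + cnj d * ip N y u"
  using ip_lincomb[OF assms, of c d] by (simp add: ip_commute[of N _ u])

lemma ip_scale_left: "ip N (\<lambda>i. c * x i) u = cnj c * ip N x u"
  using ip_scale[of N u c x] by (simp add: ip_commute[of N _ u])

lemma ip_sum:
  assumes "finite K" "u \<in> ell2 N" "\<And>k. k \<in> K \<Longrightarrow> f k \<in> ell2 N"
  shows "ip N u (\<lambda>i. \<Sum>k\<in>K. c k * f k i) = (\<Sum>k\<in>K. c k * ip N u (f k))"
  using assms
proof (induction K rule: finite_induct)
  case (insert k K)
  then show ?case
    by (simp add: ip_add ell2_scale ell2_sum ip_scale)
qed (simp add: ip_zero)

lemma ip_self: "x \<in> ell2 N \<Longrightarrow> ip N x x = of_real ((ell2_norm N x)\<^sup>2)"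
proof -
  assume x: "x \<in> ell2 N"
  have "((\<lambda>i. of_real ((cmod (x i))\<^sup>2) :: complex) has_sum of_real ((ell2_norm N x)\<^sup>2)) (idx N)"
    unfolding ell2_norm_power2 by (intro has_sum_of_real has_sum_infsum ell2_summable x)
  from infsumI[OF this] show ?thesis
    by (simp add: ip_def complex_norm_square mult.commute del: of_real_power)
qed

lemma ip_unit_vec:
  assumes "k \<in> idx N"
  shows "ip N (unit_vec k) x = x k"
proof -
  have "((\<lambda>i. cnj (unit_vec k i) * x i) has_sum x k) (idx N)"
    by (rule has_sum_finite_neutralI[where B = "{k}"]) (use assms in \<open>auto simp: unit_vec_def\<close>)
  then show ?thesis
    by (simp add: ip_def infsumI)
qed

lemma ip_unit_vec_right: "k \<in> idx N \<Longrightarrow> ip N x (unit_vec k) = cnj (x k)"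
  using ip_unit_vec[of k N x] ip_commute[of N x] by simp

lemma ell2_norm_unit_vec: "k \<in> idx N \<Longrightarrow> ell2_norm N (unit_vec k) = 1"
proof -
  assume k: "k \<in> idx N"
  have "complex_of_real ((ell2_norm N (unit_vec k))\<^sup>2) = 1"
    using ip_self[OF unit_vec_ell2[OF k]] ip_unit_vec[OF k, of "unit_vec k"] by (simp add: unit_vec_def)
  then have "(ell2_norm N (unit_vec k))\<^sup>2 = 1"
    using of_real_eq_1_iff by blast
  then show ?thesis
    using ell2_norm_nonneg[of N "unit_vec k"] by (simp add: power2_eq_1_iff)
qed

lemma cmod_le_ell2_norm:
  assumes "x \<in> ell2 N" "k \<in> idx N"
  shows "cmod (x k) \<le> ell2_norm N x"
  using Cauchy_Schwarz_ip[OF unit_vec_ell2 assms(1), of k] assms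
  by (simp add: ip_unit_vec ell2_norm_unit_vec)

lemma ell2_norm_scale: "ell2_norm N (\<lambda>i. c * x i) = cmod c * ell2_norm N x"
  by (simp add: ell2_norm_def norm_mult power_mult_distrib infsum_cmult_right' real_sqrt_mult)

lemma ell2_eqI:
  assumes "x \<in> ell2 N" "y \<in> ell2 N" "\<And>i. i \<in> idx N \<Longrightarrow> x i = y i"
  shows "x = y"
proof
  show "x i = y i" for i
    using assms by (cases "i \<in> idx N") (auto simp: ell2_outside)
qed

text \<open>The inner products of the projection \<open>p\<close> with \<open>x\<close> and with
  itself both equal \<open>S\<close>, so the squared norm of \<open>x - p\<close> is that of
  \<open>x\<close> minus \<open>S\<close>.\<close>

lemma Bessel_ip:
  assumes f: "\<And>n. n \<in> K \<Longrightarrow> f n \<in> ell2 N"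
    and orth: "\<And>m n. m \<in> K \<Longrightarrow> n \<in> K \<Longrightarrow> ip N (f m) (f n) = (if m = n then 1 else 0)"
    and x: "x \<in> ell2 N" and "finite K"
  shows "(\<Sum>n\<in>K. (cmod (ip N (f n) x))\<^sup>2) \<le> (ell2_norm N x)\<^sup>2"
proof -
  define p where "p = (\<lambda>i. \<Sum>n\<in>K. ip N (f n) x * f n i)"
  define S where "S = (\<Sum>n\<in>K. (cmod (ip N (f n) x))\<^sup>2)"
  have p: "p \<in> ell2 N"
    unfolding p_def by (intro ell2_sum \<open>finite K\<close> f)
  have xp: "ip N x p = of_real S"
    unfolding p_def S_def of_real_sum ip_sum[where f = f, OF \<open>finite K\<close> x f, simplified]
    by (intro sum.cong refl) (metis complex_norm_square ip_commute)
  have fp: "ip N (f n) p = ip N (f n) x" if "n \<in> K" for n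
  proof -
    have "ip N (f n) p = (\<Sum>m\<in>K. ip N (f m) x * (if n = m then 1 else 0))"
      unfolding p_def ip_sum[where f = f, OF \<open>finite K\<close> f[OF that] f, simplified] using orth that by (intro sum.cong) auto
    also have "\<dots> = ip N (f n) x"
      using that \<open>finite K\<close> by (simp add: if_distrib[of "(*) _"] cong: if_cong)
    finally show ?thesis .
  qed
  have "ip N p p = (\<Sum>n\<in>K. ip N (f n) x * ip N p (f n))"
    unfolding p_def by (rule ip_sum[where f = f, OF \<open>finite K\<close> p[unfolded p_def] f])
  also have "\<dots> = (\<Sum>n\<in>K. ip N (f n) x * cnj (ip N (f n) x))"
    by (intro sum.cong refl) (metis fp ip_commute)
  finally have pp: "ip N p p = of_real S"
    unfolding S_def of_real_sum by (simp only: complex_norm_square)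
  let ?d = "\<lambda>i. x i - p i"
  have d: "?d \<in> ell2 N"
    by (intro ell2_diff x p)
  have "ip N ?d ?d = ip N ?d x - ip N ?d p"
    by (rule ip_diff[OF d x p])
  also have "\<dots> = cnj (ip N x x - ip N x p) - cnj (ip N p x - ip N p p)"
    using ip_diff[OF x x p] ip_diff[OF p x p] ip_commute[of N ?d] by metis
  also have "\<dots> = of_real ((ell2_norm N x)\<^sup>2 - S)"
    using xp pp ip_commute[of N p x] ip_self[OF x] by simp
  finally have "(ell2_norm N ?d)\<^sup>2 = (ell2_norm N x)\<^sup>2 - S"
    using ip_self[OF d] of_real_eq_iff by metis
  then show ?thesis
    unfolding S_def[symmetric] using zero_le_power2[of "ell2_norm N ?d"] by linarith
qed

text \<open>Finite truncations of \<open>x\<close> converge to \<open>x\<close> in norm, since the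
  squared norm of the tail \<open>r K\<close> is that of \<open>x\<close> minus a partial sum, and
  \<open>F\<close> is continuous.\<close>

lemma bounded_functional_has_sum:
  assumes add: "\<And>x y. x \<in> ell2 N \<Longrightarrow> y \<in> ell2 N \<Longrightarrow> F (\<lambda>i. x i + y i) = F x + F y"
    and scale: "\<And>c x. x \<in> ell2 N \<Longrightarrow> F (\<lambda>i. c * x i) = c * F x"
    and bound: "\<And>x. x \<in> ell2 N \<Longrightarrow> cmod (F x) \<le> B * ell2_norm N x"
    and x: "x \<in> ell2 N"
  shows "((\<lambda>j. x j * F (unit_vec j)) has_sum F x) (idx N)"
proof -
  define r where "r K = (\<lambda>i. x i - (\<Sum>k\<in>K. x k * unit_vec k i))" for K
  have zero: "F (\<lambda>i. 0) = 0"
    using scale[OF ell2_zero, of 0] by simp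
  have fin: "F (\<lambda>i. \<Sum>k\<in>K. x k * unit_vec k i) = (\<Sum>k\<in>K. x k * F (unit_vec k))"
    if "finite K" "K \<subseteq> idx N" for K
    using that
  proof (induction K rule: finite_induct)
    case (insert k K)
    have "F (\<lambda>i. x k * unit_vec k i + (\<Sum>k\<in>K. x k * unit_vec k i)) =
        F (\<lambda>i. x k * unit_vec k i) + F (\<lambda>i. \<Sum>k\<in>K. x k * unit_vec k i)"
      using insert by (intro add ell2_scale ell2_sum unit_vec_ell2) auto
    then show ?case
      using insert scale[OF unit_vec_ell2] by simp
  qed (simp add: zero)
  have dist: "cmod ((\<Sum>k\<in>K. x k * F (unit_vec k)) - F x) \<le>
      B * sqrt ((ell2_norm N x)\<^sup>2 - (\<Sum>k\<in>K. (cmod (x k))\<^sup>2))"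
    if K: "finite K" "K \<subseteq> idx N" for K
  proof -
    have s: "(\<lambda>i. \<Sum>k\<in>K. x k * unit_vec k i) \<in> ell2 N"
      using K by (intro ell2_sum unit_vec_ell2) auto
    have r: "r K \<in> ell2 N"
      unfolding r_def by (intro ell2_diff x s)
    have rv: "r K i = (if i \<in> K then 0 else x i)" for i
      unfolding r_def unit_vec_def using K
      by (simp add: if_distrib[of "(*) _"] cong: if_cong)
    have "(ell2_norm N (r K))\<^sup>2 = (\<Sum>\<^sub>\<infinity>i\<in>idx N - K. (cmod (x i))\<^sup>2)"
      unfolding ell2_norm_power2 by (rule infsum_cong_neutral) (auto simp: rv)
    also have "\<dots> = (ell2_norm N x)\<^sup>2 - (\<Sum>k\<in>K. (cmod (x k))\<^sup>2)"
      unfolding ell2_norm_power2 using K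
      by (subst infsum_Diff) (auto intro: ell2_summable x)
    finally have n: "ell2_norm N (r K) = sqrt ((ell2_norm N x)\<^sup>2 - (\<Sum>k\<in>K. (cmod (x k))\<^sup>2))"
      using ell2_norm_nonneg[of N "r K"] by (metis real_sqrt_unique)
    have "F x = F (\<lambda>i. r K i + (\<Sum>k\<in>K. x k * unit_vec k i))"
      by (simp add: r_def)
    also have "\<dots> = F (r K) + (\<Sum>k\<in>K. x k * F (unit_vec k))"
      by (simp add: add[OF r s] fin[OF K])
    finally have "(\<Sum>k\<in>K. x k * F (unit_vec k)) - F x = - F (r K)"
      by simp
    then show ?thesis
      using bound[OF r] n by simp
  qed
  have "((\<lambda>K. (\<Sum>k\<in>K. (cmod (x k))\<^sup>2)) \<longlongrightarrow> (ell2_norm N x)\<^sup>2) (finite_subsets_at_top (idx N))"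
    unfolding ell2_norm_power2 by (intro infsum_tendsto ell2_summable x)
  then have "((\<lambda>K. B * sqrt ((ell2_norm N x)\<^sup>2 - (\<Sum>k\<in>K. (cmod (x k))\<^sup>2))) \<longlongrightarrow>
      B * sqrt ((ell2_norm N x)\<^sup>2 - (ell2_norm N x)\<^sup>2)) (finite_subsets_at_top (idx N))"
    by (intro tendsto_intros)
  then have "((\<lambda>K. B * sqrt ((ell2_norm N x)\<^sup>2 - (\<Sum>k\<in>K. (cmod (x k))\<^sup>2))) \<longlongrightarrow> 0)
      (finite_subsets_at_top (idx N))"
    by simp
  then have "((\<lambda>K. (\<Sum>k\<in>K. x k * F (unit_vec k)) - F x) \<longlongrightarrow> 0) (finite_subsets_at_top (idx N))"
    by (rule Lim_null_comparison[rotated]) (auto intro!: eventually_finite_subsets_at_top_weakI dist)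
  then show ?thesis
    unfolding has_sum_def by (simp add: LIM_zero_iff)
qed

subsection \<open>Bounded and unitary matrices\<close>

lemma mat_app_outside: "i \<notin> idx N \<Longrightarrow> mat_app N A x i = 0"
  by (simp add: mat_app_def)

lemma mat_app_ell2: "bounded_matrix N A \<Longrightarrow> x \<in> ell2 N \<Longrightarrow> mat_app N A x \<in> ell2 N"
  by (simp add: bounded_matrix_def)

lemma bounded_matrix_bound:
  assumes "bounded_matrix N A"
  obtains B where "0 \<le> B" "\<And>x. x \<in> ell2 N \<Longrightarrow> ell2_norm N (mat_app N A x) \<le> B * ell2_norm N x"
proof -
  obtain B where B: "\<forall>x\<in>ell2 N. ell2_norm N (mat_app N A x) \<le> B * ell2_norm N x"
    using assms by (auto simp: bounded_matrix_def)
  have "ell2_norm N (mat_app N A x) \<le> \<bar>B\<bar> * ell2_norm N x" if "x \<in> ell2 N" for x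
    using B that mult_right_mono[OF abs_ge_self[of B] ell2_norm_nonneg[of N x]] by fastforce
  then show ?thesis
    using that[of "\<bar>B\<bar>"] by simp
qed

lemma mat_app_lincomb:
  assumes A: "bounded_matrix N A" and x: "x \<in> ell2 N" and y: "y \<in> ell2 N"
  shows "mat_app N A (\<lambda>i. c * x i + d * y i) = (\<lambda>i. c * mat_app N A x i + d * mat_app N A y i)"
proof
  fix i
  show "mat_app N A (\<lambda>i. c * x i + d * y i) i = c * mat_app N A x i + d * mat_app N A y i"
  proof (cases "i \<in> idx N")
    case True
    then have s: "(\<lambda>j. A i j * x j) summable_on idx N" "(\<lambda>j. A i j * y j) summable_on idx N"
      using A x y by (auto simp: bounded_matrix_def)
    have "(\<Sum>\<^sub>\<infinity>j\<in>idx N. c * (A i j * x j) + d * (A i j * y j)) =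
        c * (\<Sum>\<^sub>\<infinity>j\<in>idx N. A i j * x j) + d * (\<Sum>\<^sub>\<infinity>j\<in>idx N. A i j * y j)"
      using s by (subst infsum_add) (auto simp: infsum_cmult_right' intro: summable_on_cmult_right)
    then show ?thesis
      using True by (simp add: mat_app_def algebra_simps)
  qed (simp add: mat_app_def)
qed

lemma mat_app_add:
  "bounded_matrix N A \<Longrightarrow> x \<in> ell2 N \<Longrightarrow> y \<in> ell2 N \<Longrightarrow>
    mat_app N A (\<lambda>i. x i + y i) = (\<lambda>i. mat_app N A x i + mat_app N A y i)"
  using mat_app_lincomb[of N A x y 1 1] by simp

lemma mat_app_diff:
  "bounded_matrix N A \<Longrightarrow> x \<in> ell2 N \<Longrightarrow> y \<in> ell2 N \<Longrightarrow>
    mat_app N A (\<lambda>i. x i - y i) = (\<lambda>i. mat_app N A x i - mat_app N A y i)"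
  using mat_app_lincomb[of N A x y 1 "-1"] by simp

lemma mat_app_scale: "mat_app N A (\<lambda>i. c * x i) = (\<lambda>i. c * mat_app N A x i)"
  by (auto simp: mat_app_def infsum_cmult_right'[symmetric] mult_ac)

lemma mat_app_zero: "mat_app N A (\<lambda>i. 0) = (\<lambda>i. 0)"
  by (auto simp: mat_app_def)

lemma mat_app_unit_vec:
  assumes "k \<in> idx N"
  shows "mat_app N A (unit_vec k) = (\<lambda>i. if i \<in> idx N then A i k else 0)"
proof -
  have "((\<lambda>j. A i j * unit_vec k j) has_sum A i k) (idx N)" for i
    by (rule has_sum_finite_neutralI[where B = "{k}"]) (use assms in \<open>auto simp: unit_vec_def\<close>)
  then show ?thesis
    by (auto simp: mat_app_def infsumI)
qed

text \<open>The double series need not converge absolutely, so the two sums are not exchanged.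
  Instead \<open>ip N y (mat_app N A x)\<close> is a bounded functional of \<open>x\<close> whose
  value at \<open>unit_vec j\<close> is the conjugate of entry \<open>j\<close> of
  \<open>mat_app N (mat_adj A) y\<close>. Boundedness is assumed of \<open>A\<close> alone, so that
  the lemma can serve to prove it for the adjoint.\<close>

lemma ip_mat_app:
  assumes A: "bounded_matrix N A" and x: "x \<in> ell2 N" and y: "y \<in> ell2 N"
  shows "ip N y (mat_app N A x) = ip N (mat_app N (mat_adj A) y) x"
proof -
  obtain B where B: "0 \<le> B" "\<And>x. x \<in> ell2 N \<Longrightarrow> ell2_norm N (mat_app N A x) \<le> B * ell2_norm N x"
    using bounded_matrix_bound[OF A] by blast
  have "((\<lambda>j. x j * ip N y (mat_app N A (unit_vec j))) has_sum ip N y (mat_app N A x)) (idx N)"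
  proof (rule bounded_functional_has_sum[where B = "ell2_norm N y * B"])
    fix u v assume "u \<in> ell2 N" "v \<in> ell2 N"
    then show "ip N y (mat_app N A (\<lambda>i. u i + v i)) = ip N y (mat_app N A u) + ip N y (mat_app N A v)"
      by (simp add: mat_app_add A ip_add y mat_app_ell2)
  next
    fix u assume u: "u \<in> ell2 N"
    have "cmod (ip N y (mat_app N A u)) \<le> ell2_norm N y * ell2_norm N (mat_app N A u)"
      by (intro Cauchy_Schwarz_ip y mat_app_ell2 A u)
    also have "\<dots> \<le> ell2_norm N y * (B * ell2_norm N u)"
      by (intro mult_left_mono B u ell2_norm_nonneg)
    finally show "cmod (ip N y (mat_app N A u)) \<le> ell2_norm N y * B * ell2_norm N u"
      by (simp add: mult_ac)
  qed (simp_all add: mat_app_scale ip_scale x)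
  moreover have "ip N y (mat_app N A (unit_vec j)) = cnj (mat_app N (mat_adj A) y j)"
    if "j \<in> idx N" for j
  proof -
    have "ip N y (mat_app N A (unit_vec j)) = (\<Sum>\<^sub>\<infinity>i\<in>idx N. cnj (y i) * A i j)"
      unfolding ip_def mat_app_unit_vec[OF that] by (intro infsum_cong) auto
    also have "\<dots> = cnj (mat_app N (mat_adj A) y j)"
      using that by (simp add: mat_app_def mat_adj_def infsum_cnj[symmetric] mult.commute del: infsum_cnj)
    finally show ?thesis .
  qed
  ultimately have "((\<lambda>j. cnj (mat_app N (mat_adj A) y j) * x j) has_sum ip N y (mat_app N A x)) (idx N)"
    by (subst (asm) has_sum_cong[where g = "\<lambda>j. cnj (mat_app N (mat_adj A) y j) * x j"]) auto
  then show ?thesis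
    by (simp add: ip_def infsumI)
qed

lemma mat_adj_mat_adj [simp]: "mat_adj (mat_adj A) = A"
  by (simp add: mat_adj_def)

text \<open>
  Testing \<open>A\<^sup>* y\<close> against its own restriction \<open>w\<close> to a finite set gives
  \<open>\<parallel>w\<parallel>\<^sup>2 = \<langle>y, A w\<rangle>\<close>, which bounds the partial sums of the norm of \<open>A\<^sup>* y\<close>.
\<close>

lemma bounded_matrix_mat_adj:
  assumes A: "bounded_matrix N A"
  shows "bounded_matrix N (mat_adj A)"
proof -
  obtain B where B: "0 \<le> B" "\<And>x. x \<in> ell2 N \<Longrightarrow> ell2_norm N (mat_app N A x) \<le> B * ell2_norm N x"
    using bounded_matrix_bound[OF A] by blast
  have summable: "(\<lambda>j. mat_adj A i j * y j) summable_on idx N" if y: "y \<in> ell2 N" and i: "i \<in> idx N" for y i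
  proof -
    have "(\<lambda>j. cnj (mat_app N A (unit_vec i) j) * y j) summable_on idx N"
      by (intro ip_summable mat_app_ell2 A unit_vec_ell2 i y)
    then show ?thesis
      by (rule summable_on_cong[THEN iffD1, rotated]) (auto simp: mat_app_unit_vec i mat_adj_def)
  qed
  have partial: "(\<Sum>j\<in>K. (cmod (mat_app N (mat_adj A) y j))\<^sup>2) \<le> (B * ell2_norm N y)\<^sup>2"
    if y: "y \<in> ell2 N" and K: "finite K" "K \<subseteq> idx N" for y K
  proof -
    define w where "w = (\<lambda>j. if j \<in> K then mat_app N (mat_adj A) y j else 0)"
    have w: "w \<in> ell2 N"
      by (rule ell2_finite_support[OF _ K(1)]) (use K in \<open>auto simp: w_def\<close>)
    have "((\<lambda>j. (cmod (w j))\<^sup>2) has_sum (\<Sum>j\<in>K. (cmod (mat_app N (mat_adj A) y j))\<^sup>2)) (idx N)"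
      by (rule has_sum_finite_neutralI[OF K]) (auto simp: w_def)
    then have nw: "(ell2_norm N w)\<^sup>2 = (\<Sum>j\<in>K. (cmod (mat_app N (mat_adj A) y j))\<^sup>2)"
      by (simp add: ell2_norm_power2 infsumI)
    have "of_real ((ell2_norm N w)\<^sup>2) = ip N (mat_app N (mat_adj A) y) w"
      unfolding ip_self[OF w, symmetric] unfolding ip_def by (intro infsum_cong) (auto simp: w_def)
    also have "\<dots> = ip N y (mat_app N A w)"
      by (rule ip_mat_app[OF A w y, symmetric])
    finally have "(ell2_norm N w)\<^sup>2 = cmod (ip N y (mat_app N A w))"
      by (metis abs_of_nonneg norm_of_real zero_le_power2)
    also have "\<dots> \<le> ell2_norm N y * ell2_norm N (mat_app N A w)"
      by (intro Cauchy_Schwarz_ip y mat_app_ell2 A w)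
    also have "\<dots> \<le> ell2_norm N y * (B * ell2_norm N w)"
      by (intro mult_left_mono B w ell2_norm_nonneg)
    finally have "ell2_norm N w * ell2_norm N w \<le> (B * ell2_norm N y) * ell2_norm N w"
      by (simp add: power2_eq_square mult_ac)
    \<comment> \<open>The common factor is cancelled; if it is zero, the bound holds because
      \<open>0 \<le> B\<close>.\<close>
    then have "ell2_norm N w \<le> B * ell2_norm N y"
      by (metis B(1) ell2_norm_nonneg mult_nonneg_nonneg mult_right_le_imp_le order_le_less)
    then show ?thesis
      unfolding nw[symmetric] by (intro power_mono ell2_norm_nonneg)
  qed
  have mem: "mat_app N (mat_adj A) y \<in> ell2 N" if "y \<in> ell2 N" for y
    by (rule ell2_partial_sumsI[OF mat_app_outside partial[OF that]])
  have "ell2_norm N (mat_app N (mat_adj A) y) \<le> B * ell2_norm N y" if y: "y \<in> ell2 N" for y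
  proof -
    have "(ell2_norm N (mat_app N (mat_adj A) y))\<^sup>2 \<le> (B * ell2_norm N y)\<^sup>2"
      unfolding ell2_norm_power2[of N "mat_app N (mat_adj A) y"]
      by (rule infsum_le_finite_sums[OF ell2_summable[OF mem[OF y]] partial[OF y]])
    then show ?thesis
      by (rule power2_le_imp_le) (intro mult_nonneg_nonneg B ell2_norm_nonneg)
  qed
  then show ?thesis
    unfolding bounded_matrix_def using summable mem by blast
qed

section \<open>Unitary matrices as isometries\<close>

lemma unitary_matrix_mat_adj: "unitary_matrix N A \<Longrightarrow> unitary_matrix N (mat_adj A)"
  by (auto simp: unitary_matrix_def)

lemma unitary_matrix_bounded:
  "unitary_matrix N A \<Longrightarrow> bounded_matrix N A" "unitary_matrix N A \<Longrightarrow> bounded_matrix N (mat_adj A)"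
  by (auto simp: unitary_matrix_def)

lemma unitary_matrix_ell2:
  "unitary_matrix N A \<Longrightarrow> x \<in> ell2 N \<Longrightarrow> mat_app N A x \<in> ell2 N"
  "unitary_matrix N A \<Longrightarrow> x \<in> ell2 N \<Longrightarrow> mat_app N (mat_adj A) x \<in> ell2 N"
  by (auto intro: mat_app_ell2 unitary_matrix_bounded)

lemma unitary_matrix_inverse:
  "unitary_matrix N A \<Longrightarrow> x \<in> ell2 N \<Longrightarrow> mat_app N (mat_adj A) (mat_app N A x) = x"
  "unitary_matrix N A \<Longrightarrow> x \<in> ell2 N \<Longrightarrow> mat_app N A (mat_app N (mat_adj A) x) = x"
  by (auto simp: unitary_matrix_def)

lemma unitary_matrix_ip:
  assumes "unitary_matrix N A" "x \<in> ell2 N" "y \<in> ell2 N"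
  shows "ip N (mat_app N A x) (mat_app N A y) = ip N x y"
  using ip_mat_app[OF unitary_matrix_bounded(1)[OF assms(1)] assms(3)
      unitary_matrix_ell2(1)[OF assms(1,2)]]
  by (simp add: unitary_matrix_inverse[OF assms(1,2)])

lemma ell2_norm_eqI:
  "x \<in> ell2 N \<Longrightarrow> y \<in> ell2 N \<Longrightarrow> ip N x x = ip N y y \<Longrightarrow> ell2_norm N x = ell2_norm N y"
  by (metis ip_self of_real_eq_iff ell2_norm_nonneg power2_eq_imp_eq)

lemma unitary_matrix_norm:
  "unitary_matrix N A \<Longrightarrow> x \<in> ell2 N \<Longrightarrow> ell2_norm N (mat_app N A x) = ell2_norm N x"
  by (rule ell2_norm_eqI) (simp_all add: unitary_matrix_ell2 unitary_matrix_ip)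

text \<open>Bessel's inequality bounds \<open>V\<close> by 1. By orthonormality \<open>V\<close>
  maps \<open>f i\<close> to \<open>unit_vec i\<close>, which makes the adjoint a right inverse;
  totality makes \<open>V\<close> injective, so the adjoint is a left inverse as well.\<close>

lemma unitary_matrix_orthonormal_rows:
  assumes f: "\<And>n. n \<in> idx N \<Longrightarrow> f n \<in> ell2 N"
    and orth: "\<And>m n. m \<in> idx N \<Longrightarrow> n \<in> idx N \<Longrightarrow> ip N (f m) (f n) = (if m = n then 1 else 0)"
    and total: "\<And>y. y \<in> ell2 N \<Longrightarrow> (\<And>n. n \<in> idx N \<Longrightarrow> ip N (f n) y = 0) \<Longrightarrow> y = (\<lambda>i. 0)"
    and V: "\<And>i j. i \<in> idx N \<Longrightarrow> V i j = cnj (f i j)"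
  shows "unitary_matrix N V"
proof -
  have Vx: "mat_app N V x i = ip N (f i) x" if "i \<in> idx N" for x i
    using that by (simp add: mat_app_def ip_def V)
  have partial: "(\<Sum>n\<in>K. (cmod (mat_app N V x n))\<^sup>2) \<le> (ell2_norm N x)\<^sup>2"
    if x: "x \<in> ell2 N" and K: "finite K" "K \<subseteq> idx N" for x K
  proof -
    have "(\<Sum>n\<in>K. (cmod (mat_app N V x n))\<^sup>2) = (\<Sum>n\<in>K. (cmod (ip N (f n) x))\<^sup>2)"
      using K by (intro sum.cong) (auto simp: Vx)
    also have "\<dots> \<le> (ell2_norm N x)\<^sup>2"
      by (rule Bessel_ip) (use K x f orth in \<open>auto simp: subset_iff\<close>)
    finally show ?thesis .
  qed
  have mem: "mat_app N V x \<in> ell2 N" if "x \<in> ell2 N" for x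
    by (rule ell2_partial_sumsI[OF mat_app_outside partial[OF that]])
  have le: "ell2_norm N (mat_app N V x) \<le> 1 * ell2_norm N x" if x: "x \<in> ell2 N" for x
  proof -
    have "(ell2_norm N (mat_app N V x))\<^sup>2 \<le> (ell2_norm N x)\<^sup>2"
      unfolding ell2_norm_power2[of N "mat_app N V x"]
      by (rule infsum_le_finite_sums[OF ell2_summable[OF mem[OF x]] partial[OF x]])
    then show ?thesis
      using power2_le_imp_le[OF _ ell2_norm_nonneg] by simp
  qed
  have "(\<lambda>j. V i j * x j) summable_on idx N" if "x \<in> ell2 N" "i \<in> idx N" for x i
    using ip_summable[OF f[OF that(2)] that(1)] by (simp add: V that)
  with mem le have bV: "bounded_matrix N V"
    unfolding bounded_matrix_def by blast
  note bV' = bounded_matrix_mat_adj[OF bV]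
  have VV': "mat_app N V (mat_app N (mat_adj V) y) = y" if y: "y \<in> ell2 N" for y
  proof (rule ell2_eqI[OF mem[OF mat_app_ell2[OF bV' y]] y])
    fix i assume i: "i \<in> idx N"
    have "mat_app N V (mat_app N (mat_adj V) y) i = ip N (f i) (mat_app N (mat_adj V) y)"
      by (rule Vx[OF i])
    also have "\<dots> = ip N (mat_app N V (f i)) y"
      using ip_mat_app[OF bV' y f[OF i]] by simp
    also have "mat_app N V (f i) = unit_vec i"
      by (rule ell2_eqI[OF mem[OF f[OF i]] unit_vec_ell2[OF i]]) (use i in \<open>auto simp: Vx orth unit_vec_def\<close>)
    finally show "mat_app N V (mat_app N (mat_adj V) y) i = y i"
      by (simp add: ip_unit_vec i)
  qed
  have V'V: "mat_app N (mat_adj V) (mat_app N V x) = x" if x: "x \<in> ell2 N" for x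
  proof -
    define d where "d = (\<lambda>i. mat_app N (mat_adj V) (mat_app N V x) i - x i)"
    have m: "mat_app N (mat_adj V) (mat_app N V x) \<in> ell2 N"
      by (intro mat_app_ell2 bV' bV x)
    have "mat_app N V d = (\<lambda>i. 0)"
      unfolding d_def mat_app_diff[OF bV m x] by (simp add: VV' mem x)
    then have "d = (\<lambda>i. 0)"
      using ell2_diff[OF m x] by (intro total) (auto simp: d_def simp flip: Vx)
    then show ?thesis
      unfolding d_def by (metis eq_iff_diff_eq_0 ext)
  qed
  show ?thesis
    unfolding unitary_matrix_def using bV bV' VV' V'V by blast
qed

subsection \<open>The entries of \<open>C(\<^bold>a)\<close>\<close>

lemma Cmat_odd_row: "Cmat a (2*l+1) j =
    (if j = 2*l then - of_real (rho a (2*l)) * ext0 a (2*l+1)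
     else if j = 2*l+1 then - cnj (ext0 a (2*l)) * ext0 a (2*l+1)
     else if j = 2*l+2 then - of_real (rho a (2*l+1)) * ext0 a (2*l+2)
     else if j = 2*l+3 then of_real (rho a (2*l+1)) * of_real (rho a (2*l+2)) else 0)"
  by (simp add: Cmat_def Let_def)

lemma Cmat_even_row: "Cmat a (2*l+2) j =
    (if j = 2*l then of_real (rho a (2*l)) * of_real (rho a (2*l+1))
     else if j = 2*l+1 then cnj (ext0 a (2*l)) * of_real (rho a (2*l+1))
     else if j = 2*l+2 then - cnj (ext0 a (2*l+1)) * ext0 a (2*l+2)
     else if j = 2*l+3 then cnj (ext0 a (2*l+1)) * of_real (rho a (2*l+2)) else 0)"
  by (simp add: Cmat_def Let_def)

lemma odd_or_even_index:
  assumes "1 \<le> (n::nat)"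
  obtains l where "n = 2*l+1" | l where "n = 2*l+2"
proof (cases "odd n")
  case True
  then show ?thesis
    using that(1) by (elim oddE)
next
  case False
  then obtain m where "n = 2 * m"
    by auto
  then show ?thesis
    using that(2)[of "m - 1"] assms by simp
qed

lemma Cmat_banded: "1 \<le> i \<Longrightarrow> \<bar>int i - int j\<bar> > 2 \<Longrightarrow> Cmat a i j = 0"
  by (cases i rule: odd_or_even_index) (auto simp only: Cmat_odd_row Cmat_even_row split: if_splits; simp)+

lemma para_tridiagonal_Cmat: "para_tridiagonal N (Cmat a)"
  unfolding para_tridiagonal_def
proof (intro conjI ballI allI impI)
  show "Cmat a i j = 0" if "i \<in> idx N" "\<bar>int i - int j\<bar> > 2" for i j
    using that by (intro Cmat_banded) (simp_all add: idx_def)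
next
  fix k :: nat assume "1 \<le> k"
  \<comment> \<open>Row \<open>2 * k\<close> is the even row with parameter \<open>l = k - 1\<close>
    and ends at column \<open>2 * k + 1\<close>; row \<open>2 * k + 1\<close> starts at column
    \<open>2 * k\<close>.\<close>
  then obtain l where k: "k = Suc l"
    by (cases k) auto
  show "Cmat a (2 * k) (2 * k + 2) = 0"
    using Cmat_even_row[of a l "2 * k + 2"] k by simp
  show "Cmat a (2 * k + 1) (2 * k - 1) = 0"
    using Cmat_odd_row[of a k "2 * k - 1"] k by simp
qed

subsection \<open>Unitary Hessenberg matrices\<close>

locale unitary_hessenberg =
  fixes N :: enat and H :: cmat and a :: cvec
  assumes N_nonzero: "N \<noteq> 0"
    and unitary: "unitary_matrix N H"
    and irreducible: "irreducible_hessenberg N H"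
    and a_eq: "\<And>n. n \<in> idx N \<Longrightarrow> a n = - H 1 n / cnj (tau H n)"
begin

abbreviation U :: "cvec \<Rightarrow> cvec" where "U \<equiv> mat_app N H"
abbreviation U' :: "cvec \<Rightarrow> cvec" where "U' \<equiv> mat_app N (mat_adj H)"
abbreviation ip' :: "cvec \<Rightarrow> cvec \<Rightarrow> complex" where "ip' \<equiv> ip N"

definition phase :: "nat \<Rightarrow> complex" where
  "phase n = tau H n / of_real (cmod (tau H n))"

definition phi :: "nat \<Rightarrow> cvec" where
  "phi n = (\<lambda>i. if i = n \<and> n \<in> idx N then phase n else 0)"

text \<open>For \<open>n\<close> in \<open>idx N\<close> this is the span of e_1, U e_1, ...,
  U^(n-1) e_1, by irreducibility. With \<open>U\<close> read as multiplication by the variable and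
  e_1 as the constant 1, it consists of the polynomials of degree less than
  \<open>n\<close>.\<close>

definition polys :: "nat \<Rightarrow> cvec set" where
  "polys n = {x \<in> ell2 N. \<forall>i>n. x i = 0}"

lemma one_idx: "1 \<in> idx N" "Suc 0 \<in> idx N"
  using one_in_idx[OF N_nonzero] by simp_all

lemma idx_ge1: "n \<in> idx N \<Longrightarrow> 1 \<le> n"
  by (simp add: idx_def)

lemma U_ell2: "x \<in> ell2 N \<Longrightarrow> U x \<in> ell2 N" and U'_ell2: "x \<in> ell2 N \<Longrightarrow> U' x \<in> ell2 N"
  by (simp_all add: unitary_matrix_ell2[OF unitary])

lemma U'_U: "x \<in> ell2 N \<Longrightarrow> U' (U x) = x" and U_U': "x \<in> ell2 N \<Longrightarrow> U (U' x) = x"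
  by (simp_all add: unitary_matrix_inverse[OF unitary])

lemma ip_U: "x \<in> ell2 N \<Longrightarrow> y \<in> ell2 N \<Longrightarrow> ip' y (U x) = ip' (U' y) x"
  by (intro ip_mat_app unitary_matrix_bounded[OF unitary])

lemma ip_U_U: "x \<in> ell2 N \<Longrightarrow> y \<in> ell2 N \<Longrightarrow> ip' (U x) (U y) = ip' x y"
  by (rule unitary_matrix_ip[OF unitary])

lemma subdiag: "n \<in> idx N \<Longrightarrow> Suc n \<in> idx N \<Longrightarrow> H (Suc n) n \<noteq> 0"
  using irreducible by (simp add: irreducible_hessenberg_def)

lemma below_subdiag: "i \<in> idx N \<Longrightarrow> j \<in> idx N \<Longrightarrow> Suc j < i \<Longrightarrow> H i j = 0"
  using irreducible by (simp add: irreducible_hessenberg_def hessenberg_def)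

lemma tau_1: "tau H 1 = 1" "tau H (Suc 0) = 1"
  by (simp_all add: tau_def)

lemma tau_Suc: "1 \<le> n \<Longrightarrow> tau H (Suc n) = H (Suc n) n * tau H n"
  by (cases n) (simp_all add: tau_def prod.nat_ivl_Suc' mult.commute)

lemma tau_nonzero: "n \<in> idx N \<Longrightarrow> tau H n \<noteq> 0"
proof (induction n)
  case (Suc n)
  show ?case
  proof (cases "n = 0")
    case False
    then have "n \<in> idx N"
      using idx_down[OF Suc.prems, of n] by simp
    then show ?thesis
      using Suc False subdiag by (simp add: tau_Suc)
  qed (simp add: tau_1)
qed (simp add: idx_def)

lemma phase_1: "phase 1 = 1" "phase (Suc 0) = 1"
  by (simp_all add: phase_def tau_1)

lemma cmod_phase: "n \<in> idx N \<Longrightarrow> cmod (phase n) = 1"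
  by (simp add: phase_def norm_divide tau_nonzero)

lemma phase_cnj: "n \<in> idx N \<Longrightarrow> phase n * cnj (phase n) = 1"
  using complex_norm_square[of "phase n"] by (simp add: cmod_phase)

lemma phase_Suc:
  assumes "n \<in> idx N" "Suc n \<in> idx N"
  shows "of_real (cmod (H (Suc n) n)) * phase (Suc n) = H (Suc n) n * phase n"
  using subdiag[OF assms] idx_ge1[OF assms(1)] by (simp add: phase_def tau_Suc norm_mult)

lemma phase_tau: "n \<in> idx N \<Longrightarrow> phase n * cnj (tau H n) = of_real (cmod (tau H n))"
  using complex_norm_square[of "tau H n"] tau_nonzero[of n]
  by (simp add: phase_def field_simps power2_eq_square)

lemma phi_eq: "n \<in> idx N \<Longrightarrow> phi n = (\<lambda>i. phase n * unit_vec n i)"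
  by (auto simp: phi_def unit_vec_def)

lemma phi_outside: "n \<notin> idx N \<Longrightarrow> phi n = (\<lambda>i. 0)"
  by (simp add: phi_def)

lemma phi_1: "phi (Suc 0) = unit_vec 1"
  by (auto simp: phi_def unit_vec_def phase_1 one_idx)

lemma phi_ell2: "phi n \<in> ell2 N"
  by (cases "n \<in> idx N") (simp_all add: phi_eq phi_outside ell2_scale unit_vec_ell2 ell2_zero)

lemma ip_phi: "n \<in> idx N \<Longrightarrow> ip' (phi n) x = cnj (phase n) * x n"
  by (simp add: phi_eq ip_scale_left ip_unit_vec)

lemma ip_phi_right: "n \<in> idx N \<Longrightarrow> ip' x (phi n) = phase n * cnj (x n)"
  by (simp add: phi_eq ip_scale ip_unit_vec_right)

lemma phi_self: "n \<in> idx N \<Longrightarrow> phi n n = phase n"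
  by (simp add: phi_def)

lemma polys_ell2: "x \<in> polys n \<Longrightarrow> x \<in> ell2 N"
  by (simp add: polys_def)

lemma polys_mono: "x \<in> polys m \<Longrightarrow> m \<le> n \<Longrightarrow> x \<in> polys n"
  by (simp add: polys_def)

lemma phi_polys: "phi n \<in> polys n"
  using phi_ell2 by (simp add: polys_def) (simp add: phi_def)

lemma polys_lincomb:
  "x \<in> polys n \<Longrightarrow> y \<in> polys n \<Longrightarrow> (\<lambda>i. c * x i + d * y i) \<in> polys n"
  by (simp add: polys_def ell2_add ell2_scale)

lemma U_polys: "x \<in> polys n \<Longrightarrow> U x \<in> polys (Suc n)"
proof -
  assume x: "x \<in> polys n"
  have "H i j * x j = 0" if "Suc n < i" "i \<in> idx N" "j \<in> idx N" for i j
  proof (cases "j \<le> n")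
    case True
    then show ?thesis
      using that below_subdiag by simp
  next
    case False
    then show ?thesis
      using x by (simp add: polys_def)
  qed
  then have "U x i = 0" if "Suc n < i" for i
    using that by (auto simp: mat_app_def intro!: infsum_0)
  then show ?thesis
    using x by (simp add: polys_def U_ell2)
qed

text \<open>Column \<open>k\<close> of \<open>H\<close> vanishes below row \<open>k + 1\<close> and
  \<open>u\<close> vanishes up to \<open>k\<close>, so the inner product reduces to its term at
  \<open>k + 1\<close>, whose coefficient is nonzero by irreducibility.\<close>

lemma hessenberg_step:
  assumes u: "u \<in> ell2 N" and k: "k \<in> idx N" "Suc k \<in> idx N"
    and zero: "\<And>i. i \<in> idx N \<Longrightarrow> i \<le> k \<Longrightarrow> u i = 0"
    and orth: "ip' (U (unit_vec k)) u = 0"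
  shows "u (Suc k) = 0"
proof -
  have "((\<lambda>i. cnj (U (unit_vec k) i) * u i) has_sum cnj (H (Suc k) k) * u (Suc k)) (idx N)"
  proof (rule has_sum_finite_neutralI[where B = "{Suc k}"])
    fix i assume "i \<in> idx N - {Suc k}"
    then show "cnj (U (unit_vec k) i) * u i = 0"
      using zero[of i] below_subdiag[of i k] k by (cases "i \<le> k") (auto simp: mat_app_unit_vec)
  qed (use k in \<open>auto simp: mat_app_unit_vec\<close>)
  then have "ip' (U (unit_vec k)) u = cnj (H (Suc k) k) * u (Suc k)"
    by (simp add: ip_def infsumI)
  then show ?thesis
    using orth subdiag[OF k] by simp
qed

text \<open>This iterates \<open>hessenberg_step\<close>. The orthogonality may be proved knowing
  that \<open>u\<close> vanishes up to \<open>k\<close>; for an eigenvector, where the inner product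
  is a multiple of \<open>u k\<close>, that knowledge is what yields it.\<close>

lemma hessenberg_zeroI:
  assumes u: "u \<in> ell2 N" and "u 1 = 0"
    and orth: "\<And>k. k \<in> idx N \<Longrightarrow> Suc k \<in> idx N \<Longrightarrow> (\<And>i. i \<in> idx N \<Longrightarrow> i \<le> k \<Longrightarrow> u i = 0) \<Longrightarrow>
      ip' (U (unit_vec k)) u = 0"
  shows "u = (\<lambda>i. 0)"
proof (rule ell2_eqI[OF u ell2_zero])
  show "u i = 0" if "i \<in> idx N" for i
    using that
  proof (induction i rule: less_induct)
    case (less i)
    show ?case
    proof (cases "i \<le> 1")
      case True
      then have "i = 1"
        using idx_ge1[OF less.prems] by simp
      then show ?thesis
        using \<open>u 1 = 0\<close> by simp
    next
      case False
      then obtain k where k: "i = Suc k" "1 \<le> k"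
        by (cases i) auto
      then have ki: "k \<in> idx N" "Suc k \<in> idx N"
        using idx_down[OF less.prems, of k] less.prems by simp_all
      have zero: "u j = 0" if "j \<in> idx N" "j \<le> k" for j
        using less.IH[of j] that k by simp
      show ?thesis
        unfolding k(1) by (rule hessenberg_step[OF u ki zero orth[OF ki zero]])
    qed
  qed
qed

text \<open>
  \<open>phi n\<close> and \<open>phi_star n\<close> stand for \<open>\<phi>\<^bsub>n-1\<^esub>\<close> and \<open>\<phi>\<^sup>*\<^bsub>n-1\<^esub>\<close>. Since \<open>ext0 a 0 = 1\<close> and \<open>rho a 0 = 0\<close>, the
  recursion gives \<open>phi_star 1 = e\<^sub>1\<close>; since \<open>phi (N+1) = 0\<close>, no special treatment of \<open>n = N\<close> is needed.
\<close>

primrec phi_star :: "nat \<Rightarrow> cvec" where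
  "phi_star 0 = (\<lambda>i. 0)"
| "phi_star (Suc n) = (\<lambda>i. cnj (ext0 a n) * phi (Suc n) i + of_real (rho a n) * phi_star n i)"

text \<open>The positive first entry fixes the phase that the other conditions leave open, and its
  value turns the formula for \<open>a n\<close> into a coefficient of the recursion.\<close>

definition szego :: "nat \<Rightarrow> bool" where
  "szego n \<longleftrightarrow> phi_star n \<in> polys n \<and> ip' (phi_star n) (phi_star n) = 1 \<and> phi_star n 1 = of_real (cmod (tau H n)) \<and>
     (\<forall>k. 1 \<le> k \<and> k < n \<longrightarrow> ip' (U (unit_vec k)) (phi_star n) = 0)"

lemma ext0_pos: "1 \<le> n \<Longrightarrow> ext0 a n = a n"
  by (simp add: ext0_def)

lemma rho_0: "rho a 0 = 0"
  by (simp add: rho_def ext0_def)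

lemma phi_star_1: "phi_star (Suc 0) = unit_vec 1"
  by (simp add: phi_1 ext0_def)

text \<open>The left side is the first entry of \<open>U (phi n)\<close>, the right side that of
  \<open>- a n\<close> times \<open>phi_star n\<close>.\<close>

lemma a_phase: "n \<in> idx N \<Longrightarrow> phase n * H 1 n = - a n * of_real (cmod (tau H n))"
  unfolding phase_tau[of n, symmetric] using a_eq[of n] tau_nonzero[of n] by simp

text \<open>The difference \<open>d\<close> of the two sides vanishes beyond \<open>n\<close> by the
  choice of phases, at 1 by the formula for \<open>a n\<close>, and in between because it is
  orthogonal to \<open>U (unit_vec k)\<close> for \<open>k < n\<close>. As \<open>U\<close> is an
  isometry, Pythagoras then gives the sum of squares.\<close>

lemma szego_step:
  assumes n: "n \<in> idx N" and sz: "szego n"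
  shows "U (phi n) = (\<lambda>i. of_real (rho a n) * phi (Suc n) i + (- a n) * phi_star n i)"
    and "cmod (a n) \<le> 1"
    and "rho a n = (if Suc n \<in> idx N then cmod (H (Suc n) n) else 0)"
    and "(cmod (a n))\<^sup>2 + (rho a n)\<^sup>2 = 1"
proof -
  \<comment> \<open>This candidate for \<open>rho a n\<close> is identified with it only by the norm
    computation at the end. At the last index \<open>phi (Suc n)\<close> is zero, and the
    computation shows that \<open>a n\<close> has modulus 1, in accordance with
    \<open>r = 0\<close>.\<close>
  define r where "r = (if Suc n \<in> idx N then cmod (H (Suc n) n) else 0)"
  have n1: "1 \<le> n"
    by (rule idx_ge1[OF n])
  have phi_star: "phi_star n \<in> polys n" "ip' (phi_star n) (phi_star n) = 1" "phi_star n 1 = of_real (cmod (tau H n))"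
    and orth: "\<And>k. 1 \<le> k \<Longrightarrow> k < n \<Longrightarrow> ip' (U (unit_vec k)) (phi_star n) = 0"
    using sz by (auto simp: szego_def)
  have gl: "phi_star n \<in> ell2 N"
    by (rule polys_ell2[OF phi_star(1)])
  have Ueh: "U (phi n) i = (if i \<in> idx N then phase n * H i n else 0)" for i
    by (simp add: phi_eq[OF n] mat_app_scale mat_app_unit_vec[OF n])
  define v where "v = (\<lambda>i. of_real r * phi (Suc n) i + (- a n) * phi_star n i)"
  have v: "v \<in> ell2 N"
    unfolding v_def by (intro ell2_add ell2_scale phi_ell2 gl)
  define d where "d = (\<lambda>i. U (phi n) i - v i)"
  have d: "d \<in> ell2 N"
    unfolding d_def by (intro ell2_diff U_ell2 phi_ell2 v)
  have d_high: "d i = 0" if i: "i \<in> idx N" "n < i" for i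
  proof (cases "i = Suc n")
    case True
    then show ?thesis
      using i phi_star(1) phase_Suc[OF n] by (simp add: d_def v_def Ueh r_def phi_self polys_def mult_ac)
  next
    case False
    then show ?thesis
      using i phi_star(1) below_subdiag[of i n] n by (simp add: d_def v_def Ueh polys_def) (simp add: phi_def)
  qed
  have "d 1 = 0"
    using n1 a_phase[OF n] one_idx phi_star(3) by (simp add: d_def v_def Ueh) (simp add: phi_def)
  moreover have "ip' (U (unit_vec k)) d = 0"
    if k: "k \<in> idx N" "Suc k \<in> idx N" and zero: "\<And>i. i \<in> idx N \<Longrightarrow> i \<le> k \<Longrightarrow> d i = 0" for k
  proof (cases "k < n")
    case True
    note Uk = U_ell2[OF unit_vec_ell2[OF k(1)]]
    have "ip' (U (unit_vec k)) (U (phi n)) = 0"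
      using True by (simp add: ip_U_U unit_vec_ell2 k phi_ell2 ip_unit_vec) (simp add: phi_def)
    moreover have "ip' (U (unit_vec k)) (phi (Suc n)) = 0"
    proof (cases "Suc n \<in> idx N")
      case True
      then show ?thesis
        using \<open>k < n\<close> below_subdiag[of "Suc n" k] k by (simp add: ip_phi_right mat_app_unit_vec)
    qed (simp add: phi_outside ip_zero)
    ultimately show ?thesis
      using True orth[of k] idx_ge1[OF k(1)]
      unfolding d_def ip_diff[OF Uk U_ell2[OF phi_ell2] v]
      unfolding v_def ip_lincomb[OF Uk phi_ell2 gl] by simp
  next
    \<comment> \<open>For \<open>n \<le> k\<close> the entries up to \<open>k\<close> and those
      beyond \<open>n\<close> are all entries, so \<open>d\<close> is already zero.\<close>
    case False
    then have "d i = 0" if "i \<in> idx N" for i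
      using that zero[of i] d_high[of i] by (cases "i \<le> k") auto
    then have "d = (\<lambda>i. 0)"
      by (intro ell2_eqI[OF d ell2_zero])
    then show ?thesis
      by (simp add: ip_zero)
  qed
  ultimately have "d = (\<lambda>i. 0)"
    by (rule hessenberg_zeroI[OF d])
  then have Uv: "U (phi n) = v"
    unfolding d_def by (metis eq_iff_diff_eq_0 ext)
  have eg: "ip' (phi (Suc n)) (phi_star n) = 0"
    using phi_star(1) ip_scale_left[of N 0 "phi (Suc n)" "phi_star n"]
    by (cases "Suc n \<in> idx N") (simp_all add: ip_phi polys_def phi_outside)
  then have ge: "ip' (phi_star n) (phi (Suc n)) = 0"
    by (subst ip_commute) simp
  have ee: "of_real r * (of_real r * ip' (phi (Suc n)) (phi (Suc n))) = of_real (r\<^sup>2)"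
    by (cases "Suc n \<in> idx N")
      (simp_all add: ip_phi phi_self r_def power2_eq_square phase_cnj mult.commute[of "cnj _"])
  have "1 = ip' v v"
    unfolding Uv[symmetric] ip_U_U[OF phi_ell2 phi_ell2]
    by (simp add: ip_phi n phi_self phase_cnj mult.commute[of "cnj _"])
  also have "\<dots> = of_real (r\<^sup>2) + of_real ((cmod (a n))\<^sup>2)"
    unfolding v_def ip_lincomb[OF v[unfolded v_def] phi_ell2 gl]
      ip_lincomb_left[OF phi_ell2 phi_ell2 gl] ip_lincomb_left[OF gl phi_ell2 gl]
    using ee by (simp add: eg ge phi_star complex_norm_square del: of_real_power)
  finally have "of_real (r\<^sup>2 + (cmod (a n))\<^sup>2) = (1 :: complex)"
    by simp
  then have r2: "r\<^sup>2 + (cmod (a n))\<^sup>2 = 1"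
    using of_real_eq_1_iff by blast
  have "0 \<le> r" "r\<^sup>2 = 1 - (cmod (a n))\<^sup>2"
    using r2 by (simp_all add: r_def)
  then have rho: "rho a n = r"
    using real_sqrt_unique[of r "1 - (cmod (a n))\<^sup>2"] by (simp add: rho_def ext0_pos[OF n1])
  show "U (phi n) = (\<lambda>i. of_real (rho a n) * phi (Suc n) i + (- a n) * phi_star n i)"
    unfolding rho Uv v_def ..
  show "rho a n = (if Suc n \<in> idx N then cmod (H (Suc n) n) else 0)"
    unfolding rho r_def ..
  show "(cmod (a n))\<^sup>2 + (rho a n)\<^sup>2 = 1"
    using r2 rho by simp
  then have "(cmod (a n))\<^sup>2 \<le> 1"
    using zero_le_power2[of "rho a n"] by linarith
  then show "cmod (a n) \<le> 1"
    using abs_square_le_1[of "cmod (a n)"] by simp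
qed

text \<open>In the orthonormal vectors \<open>phi (Suc n)\<close> and \<open>phi_star n\<close>, the
  coefficients of \<open>U (phi n)\<close> are \<open>rho a n\<close>, \<open>- a n\<close> and
  those of \<open>phi_star (Suc n)\<close> are \<open>cnj (a n)\<close>, \<open>rho a n\<close>: two
  orthogonal unit vectors. The first entry gets multiplied by \<open>rho a n\<close>, the modulus of
  \<open>H (Suc n) n\<close>.\<close>

lemma szego: "n \<in> idx N \<Longrightarrow> szego n"
proof (induction n)
  case (Suc n)
  show ?case
  proof (cases "n = 0")
    case True
    then show ?thesis
      using ip_unit_vec[OF one_in_idx[OF N_nonzero], of "unit_vec 1"]
      unfolding szego_def True phi_star_1
      by (simp add: polys_def unit_vec_ell2 one_idx tau_1) (simp add: unit_vec_def)
  next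
    case False
    then have n1: "1 \<le> n" and n: "n \<in> idx N"
      using idx_down[OF Suc.prems, of n] by simp_all
    note sz = Suc.IH[OF n] and S = szego_step[OF n Suc.IH[OF n]]
    have phi_star: "phi_star n \<in> polys n" "ip' (phi_star n) (phi_star n) = 1" "phi_star n 1 = of_real (cmod (tau H n))"
      and orth: "\<And>k. 1 \<le> k \<Longrightarrow> k < n \<Longrightarrow> ip' (U (unit_vec k)) (phi_star n) = 0"
      using sz by (auto simp: szego_def)
    have gl: "phi_star n \<in> ell2 N"
      by (rule polys_ell2[OF phi_star(1)])
    have gS: "phi_star (Suc n) = (\<lambda>i. cnj (a n) * phi (Suc n) i + of_real (rho a n) * phi_star n i)"
      by (simp add: ext0_pos[OF n1])
    have gSp: "phi_star (Suc n) \<in> polys (Suc n)"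
      unfolding gS by (intro polys_lincomb phi_polys polys_mono[OF phi_star(1)]) simp
    have eg: "ip' (phi (Suc n)) (phi_star n) = 0" "ip' (phi_star n) (phi (Suc n)) = 0"
      using phi_star(1) Suc.prems by (simp_all add: ip_phi ip_phi_right polys_def)
    have ee: "ip' (phi (Suc n)) (phi (Suc n)) = 1"
      using Suc.prems by (simp add: ip_phi phi_self phase_cnj mult.commute[of "cnj _"])
    have "ip' (phi_star (Suc n)) (phi_star (Suc n)) = of_real ((cmod (a n))\<^sup>2 + (rho a n)\<^sup>2)"
      unfolding gS ip_lincomb[OF polys_ell2[OF gSp[unfolded gS]] phi_ell2 gl]
        ip_lincomb_left[OF phi_ell2 phi_ell2 gl] ip_lincomb_left[OF gl phi_ell2 gl] of_real_add
        complex_norm_square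
      by (simp add: eg ee phi_star power2_eq_square)
    then have norm: "ip' (phi_star (Suc n)) (phi_star (Suc n)) = 1"
      unfolding S(4) by simp
    have first: "phi_star (Suc n) 1 = of_real (cmod (tau H (Suc n)))"
      unfolding gS tau_Suc[OF n1] using n1 Suc.prems phi_star(3)
      by (simp add: S(3) norm_mult) (simp add: phi_def)
    have "ip' (U (unit_vec k)) (phi_star (Suc n)) = 0" if k: "1 \<le> k" "k < Suc n" for k
    proof -
      have ki: "k \<in> idx N"
        using idx_down[OF n, of k] k by simp
      note Uk = U_ell2[OF unit_vec_ell2[OF ki]]
      show ?thesis
      proof (cases "k = n")
        case False
        then have "H (Suc n) k = 0"
          using k by (intro below_subdiag Suc.prems ki) simp
        then show ?thesis
          unfolding gS ip_lincomb[OF Uk phi_ell2 gl]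
          using False k Suc.prems orth[of k] by (simp add: ip_phi_right) (simp add: mat_app_unit_vec[OF ki])
      next
        case True
        have "ip' (U (phi n)) (phi_star (Suc n)) = 0"
          unfolding gS S(1) ip_lincomb_left[OF polys_ell2[OF gSp[unfolded gS]] phi_ell2 gl]
            ip_lincomb[OF phi_ell2 phi_ell2 gl] ip_lincomb[OF gl phi_ell2 gl]
          by (simp add: eg ee phi_star)
        moreover have "U (phi n) = (\<lambda>i. phase n * U (unit_vec k) i)"
          by (simp add: phi_eq[OF n] mat_app_scale True)
        ultimately show ?thesis
          using cmod_phase[OF n] by (auto simp: ip_scale_left)
      qed
    qed
    then show ?thesis
      unfolding szego_def using gSp norm first by blast
  qed
qed (simp add: idx_def)

lemma phi_star_polys: "n \<in> idx N \<Longrightarrow> phi_star n \<in> polys n"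
  and ip_phi_star_self: "n \<in> idx N \<Longrightarrow> ip' (phi_star n) (phi_star n) = 1"
  using szego by (auto simp: szego_def)

lemma phi_star_ell2: "phi_star n \<in> ell2 N"
  by (induction n) (auto intro!: ell2_zero ell2_add ell2_scale phi_ell2)

lemma U_phi: "n \<in> idx N \<Longrightarrow> U (phi n) = (\<lambda>i. of_real (rho a n) * phi (Suc n) i + (- a n) * phi_star n i)"
  and cmod_a_le_1: "n \<in> idx N \<Longrightarrow> cmod (a n) \<le> 1"
  and rho_eq: "n \<in> idx N \<Longrightarrow> rho a n = (if Suc n \<in> idx N then cmod (H (Suc n) n) else 0)"
  and cmod_a_rho: "n \<in> idx N \<Longrightarrow> (cmod (a n))\<^sup>2 + (rho a n)\<^sup>2 = 1"
  using szego_step szego by blast+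

lemma rho_last: "n \<in> idx N \<Longrightarrow> Suc n \<notin> idx N \<Longrightarrow> rho a n = 0"
  by (simp add: rho_eq)

text \<open>\<open>U x\<close> is a combination of the vectors \<open>U (unit_vec i)\<close> with
  \<open>i \<le> m\<close>, and \<open>phi_star n\<close> is orthogonal to all of these.\<close>

lemma ip_phi_star_U:
  assumes n: "n \<in> idx N" and x: "x \<in> polys m" and "m < n"
  shows "ip' (phi_star n) (U x) = 0"
proof -
  have "cnj (U' (phi_star n) i) * x i = 0" if i: "i \<in> idx N" for i
  proof (cases "i < n")
    case True
    have "U' (phi_star n) i = ip' (U (unit_vec i)) (phi_star n)"
      using ip_mat_app[OF unitary_matrix_bounded(2)[OF unitary] phi_star_ell2 unit_vec_ell2[OF i], of n]
      by (simp add: ip_unit_vec[OF i])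
    also have "\<dots> = 0"
      using szego[OF n] True idx_ge1[OF i] by (simp add: szego_def)
    finally show ?thesis
      by simp
  qed (use x \<open>m < n\<close> in \<open>simp add: polys_def\<close>)
  then show ?thesis
    unfolding ip_U[OF polys_ell2[OF x] phi_star_ell2] by (simp add: ip_def infsum_0)
qed

subsection \<open>The CMV basis\<close>

definition chi_base :: "nat \<Rightarrow> cvec" where
  "chi_base n = (if odd n then phi_star n else phi n)"

text \<open>For indices in \<open>idx N\<close> this is, up to phases, the result of
  orthonormalising e_1, U e_1, U^-1 e_1, U^2 e_1, U^-2 e_1, ... in this order.\<close>

definition chi :: "nat \<Rightarrow> cvec" where
  "chi n = (U' ^^ ((n - 1) div 2)) (chi_base n)"

lemma U'_pow_ell2: "x \<in> ell2 N \<Longrightarrow> (U' ^^ k) x \<in> ell2 N"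
  by (induction k) (simp_all add: U'_ell2)

lemma U'_pow_lincomb:
  assumes "x \<in> ell2 N" "y \<in> ell2 N"
  shows "(U' ^^ k) (\<lambda>i. c * x i + d * y i) = (\<lambda>i. c * (U' ^^ k) x i + d * (U' ^^ k) y i)"
  by (induction k)
    (simp_all add: mat_app_lincomb[OF unitary_matrix_bounded(2)[OF unitary]] U'_pow_ell2 assms)

lemma U_U'_pow: "x \<in> ell2 N \<Longrightarrow> U ((U' ^^ k) x) = (U' ^^ k) (U x)"
proof (induction k)
  case (Suc k)
  have "U ((U' ^^ Suc k) x) = U' (U ((U' ^^ k) x))"
    by (simp add: U_U' U'_U U'_pow_ell2 Suc.prems)
  then show ?case
    using Suc by simp
qed simp

lemma U_U'_pow_Suc: "x \<in> ell2 N \<Longrightarrow> U ((U' ^^ Suc k) x) = (U' ^^ k) x"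
  by (simp add: U_U' U'_pow_ell2)

lemma ip_U'_pow:
  "x \<in> ell2 N \<Longrightarrow> y \<in> ell2 N \<Longrightarrow> ip' ((U' ^^ k) x) y = ip' x ((U ^^ k) y)"
proof (induction k arbitrary: y)
  case (Suc k)
  then have "ip' ((U' ^^ Suc k) x) y = ip' ((U' ^^ k) x) (U y)"
    by (simp add: ip_U U'_pow_ell2)
  also have "\<dots> = ip' x ((U ^^ Suc k) y)"
    using Suc by (simp add: U_ell2 funpow_swap1)
  finally show ?case .
qed simp

lemma U_pow_U'_pow: "x \<in> ell2 N \<Longrightarrow> (U ^^ (l + m)) ((U' ^^ l) x) = (U ^^ m) x"
proof (induction l)
  case (Suc l)
  have "(U ^^ (Suc l + m)) ((U' ^^ Suc l) x) = (U ^^ (l + m)) (U ((U' ^^ Suc l) x))"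
    by (simp add: funpow_swap1)
  also have "\<dots> = (U ^^ m) x"
    unfolding U_U'_pow_Suc[OF Suc.prems] by (rule Suc.IH[OF Suc.prems])
  finally show ?case .
qed simp

lemma U_pow_polys: "x \<in> polys n \<Longrightarrow> (U ^^ k) x \<in> polys (n + k)"
  by (induction k) (simp_all add: U_polys)

lemma chi_base_polys: "n \<in> idx N \<Longrightarrow> chi_base n \<in> polys n"
  by (simp add: chi_base_def phi_star_polys phi_polys)

lemma chi_base_ell2: "chi_base n \<in> ell2 N"
  by (simp add: chi_base_def phi_star_ell2 phi_ell2)

lemma ip_phi_self: "n \<in> idx N \<Longrightarrow> ip' (phi n) (phi n) = 1"
  by (simp add: ip_phi phi_self phase_cnj mult.commute[of "cnj _"])

lemma ip_chi_base_self: "n \<in> idx N \<Longrightarrow> ip' (chi_base n) (chi_base n) = 1"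
  by (simp add: chi_base_def ip_phi_star_self ip_phi_self)

lemma chi_ell2: "chi n \<in> ell2 N"
  by (simp add: chi_def U'_pow_ell2 chi_base_ell2)

lemma ip_chi: "x \<in> ell2 N \<Longrightarrow> ip' (chi n) x = ip' (chi_base n) ((U ^^ ((n - 1) div 2)) x)"
  by (simp add: chi_def ip_U'_pow chi_base_ell2)

lemma U_pow_chi:
  assumes "m \<in> idx N" "(m - 1) div 2 \<le> k"
  shows "(U ^^ k) (chi m) \<in> polys (m + (k - (m - 1) div 2))"
proof -
  have "(U ^^ k) (chi m) = (U ^^ (k - (m - 1) div 2)) (chi_base m)"
    unfolding chi_def using U_pow_U'_pow[OF chi_base_ell2, of "(m - 1) div 2" "k - (m - 1) div 2"] assms(2)
    by simp
  then show ?thesis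
    by (simp add: U_pow_polys chi_base_polys assms(1))
qed

text \<open>\<open>phi n\<close> is orthogonal to the polynomials of lower degree, but
  \<open>phi_star n\<close> to their images under \<open>U\<close>; hence the extra \<open>U\<close>
  for odd \<open>n\<close>.\<close>

lemma chi_base_orth:
  assumes n: "n \<in> idx N" and x: "x \<in> polys m" "m < n"
  shows "odd n \<Longrightarrow> ip' (chi_base n) (U x) = 0" "even n \<Longrightarrow> ip' (chi_base n) x = 0"
  using ip_phi_star_U[OF n x] x by (auto simp: chi_base_def ip_phi n polys_def)

text \<open>The powers of \<open>U'\<close> in \<open>chi n\<close> are moved onto
  \<open>chi m\<close> as powers of \<open>U\<close>, where they produce a vector of some
  \<open>polys\<close> with index below \<open>n\<close>. For odd \<open>n\<close> one power is
  split off as the \<open>U\<close> that \<open>chi_base_orth\<close> asks for.\<close>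

lemma ip_chi_less:
  assumes m: "m \<in> idx N" and n: "n \<in> idx N" and "m < n"
  shows "ip' (chi n) (chi m) = 0"
  using idx_ge1[OF n]
proof (cases n rule: odd_or_even_index)
  case (1 p)
  then obtain k where k: "p = Suc k"
    using \<open>m < n\<close> idx_ge1[OF m] by (cases p) simp_all
  have le: "(m - 1) div 2 \<le> k" "m + (k - (m - 1) div 2) < n"
    using idx_ge1[OF m] by (cases m rule: odd_or_even_index; use \<open>m < n\<close> 1 k in simp)+
  have "ip' (chi_base n) (U ((U ^^ k) (chi m))) = 0"
    using chi_base_orth(1)[OF n U_pow_chi[OF m le(1)] le(2)] 1 by simp
  then show ?thesis
    by (simp add: ip_chi chi_ell2 1 k)
next
  case (2 p)
  have le: "(m - 1) div 2 \<le> p" "m + (p - (m - 1) div 2) < n"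
    using idx_ge1[OF m] by (cases m rule: odd_or_even_index; use \<open>m < n\<close> 2 in simp)+
  show ?thesis
    using chi_base_orth(2)[OF n U_pow_chi[OF m le(1)] le(2)] 2 by (simp add: ip_chi chi_ell2)
qed

lemma ip_chi_chi:
  assumes m: "m \<in> idx N" and n: "n \<in> idx N"
  shows "ip' (chi m) (chi n) = (if m = n then 1 else 0)"
proof -
  have "ip' (chi m) (chi n) = 0" if "m < n"
    using ip_chi_less[OF m n that] by (subst ip_commute) simp
  moreover have "ip' (chi m) (chi n) = 0" if "n < m"
    by (rule ip_chi_less[OF n m that])
  moreover have "ip' (chi n) (chi n) = 1"
    using U_pow_U'_pow[OF chi_base_ell2, of "(n - 1) div 2" 0 n]
    by (simp add: ip_chi chi_ell2) (simp add: chi_def ip_chi_base_self n)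
  ultimately show ?thesis
    by (cases m n rule: linorder_cases) auto
qed

section \<open>The matrix of \<open>U\<close> in the CMV basis\<close>

lemma U'_pow_phi:
  assumes "n \<in> idx N"
  shows "(U' ^^ k) (phi n) =
    (\<lambda>i. of_real (rho a n) * (U' ^^ Suc k) (phi (Suc n)) i + (- a n) * (U' ^^ Suc k) (phi_star n) i)"
  unfolding U'_pow_lincomb[OF phi_ell2 phi_star_ell2, symmetric] U_phi[OF assms, symmetric]
  by (simp add: funpow_swap1 U'_U phi_ell2)

lemma U'_pow_phi_star:
  "(U' ^^ k) (phi_star (Suc n)) =
    (\<lambda>i. cnj (ext0 a n) * (U' ^^ k) (phi (Suc n)) i + of_real (rho a n) * (U' ^^ k) (phi_star n) i)"
  by (simp add: U'_pow_lincomb phi_ell2 phi_star_ell2)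

lemma chi_odd: "chi (2 * k + 1) = (U' ^^ k) (phi_star (2 * k + 1))"
  and chi_even: "chi (2 * k + 2) = (U' ^^ k) (phi (2 * k + 2))"
  by (simp_all add: chi_def chi_base_def)

text \<open>\<open>U\<close> commutes with the powers of \<open>U'\<close>, so the recursion for
  \<open>U (phi n)\<close> gives two terms; one more step of the recursion expands each of them in
  two basis vectors.\<close>

lemma U_chi_even:
  assumes "2 * k + 2 \<in> idx N"
  shows "U (chi (2 * k + 2)) = (\<lambda>i.
    of_real (rho a (2*k+2)) * (of_real (rho a (2*k+3)) * chi (2*k+4) i - a (2*k+3) * chi (2*k+3) i)
    - a (2*k+2) * (cnj (a (2*k+1)) * chi (2*k+2) i + of_real (rho a (2*k+1)) * chi (2*k+1) i))"
proof -
  have 1: "U (chi (2 * k + 2)) = (\<lambda>i. of_real (rho a (2*k+2)) * (U' ^^ k) (phi (2*k+3)) i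
      + (- a (2*k+2)) * (U' ^^ k) (phi_star (2*k+2)) i)"
    unfolding chi_even U_U'_pow[OF phi_ell2] U_phi[OF assms] U'_pow_lincomb[OF phi_ell2 phi_star_ell2]
    by (simp add: numeral_eq_Suc)
  have 2: "(U' ^^ k) (phi_star (2*k+2)) i =
      cnj (a (2*k+1)) * chi (2*k+2) i + of_real (rho a (2*k+1)) * chi (2*k+1) i" for i
    using U'_pow_phi_star[of k "2*k+1"] chi_odd[of k] chi_even[of k] by (simp add: ext0_pos del: phi_star.simps)
  have 3: "of_real (rho a (2*k+2)) * (U' ^^ k) (phi (2*k+3)) i =
      of_real (rho a (2*k+2)) * (of_real (rho a (2*k+3)) * chi (2*k+4) i - a (2*k+3) * chi (2*k+3) i)" for i
  proof (cases "2*k+3 \<in> idx N")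
    case True
    show ?thesis
      using U'_pow_phi[OF True, of k] chi_odd[of "Suc k"] chi_even[of "Suc k"]
      by (simp add: numeral_eq_Suc del: phi_star.simps funpow.simps)
  next
    \<comment> \<open>Here \<open>phi (2*k+3)\<close> is zero and \<open>a (2*k+3)\<close> is
      arbitrary; both sides vanish through the factor \<open>rho a (2*k+2)\<close>.\<close>
    case False
    then have "rho a (2*k+2) = 0"
      using rho_last[OF assms] by (simp add: numeral_eq_Suc)
    then show ?thesis
      by simp
  qed
  show ?thesis
    unfolding 1 2 3 by (simp only: diff_conv_add_uminus mult_minus_left)
qed

text \<open>For \<open>k > 0\<close>, \<open>U\<close> cancels one power of \<open>U'\<close>, and
  the two terms of the recursion for \<open>phi_star\<close> are again expanded once more.\<close>

lemma U_chi_odd: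
  assumes n: "2 * k + 1 \<in> idx N"
  shows "U (chi (2 * k + 1)) = (\<lambda>i.
    cnj (ext0 a (2*k)) * (of_real (rho a (2*k+1)) * chi (2*k+2) i - a (2*k+1) * chi (2*k+1) i)
    + of_real (rho a (2*k)) * (cnj (ext0 a (2*k-1)) * chi (2*k) i + of_real (rho a (2*k-1)) * chi (2*k-1) i))"
proof (cases k)
  \<comment> \<open>The truncated indices \<open>2*k\<close> and \<open>2*k-1\<close> are both 0,
    and the bracket that contains them is multiplied by \<open>rho a 0 = 0\<close>.\<close>
  case 0
  then show ?thesis
    using U_phi[of 1] one_idx chi_odd[of 0] chi_even[of 0]
    by (simp add: rho_0 ext0_def numeral_2_eq_2)
next
  case (Suc l)
  have "U (chi (2*k+1)) = (U' ^^ l) (phi_star (2*k+1))"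
    unfolding chi_odd unfolding Suc U_U'_pow_Suc[OF phi_star_ell2] ..
  also have "\<dots> = (\<lambda>i. cnj (ext0 a (2*k)) * (U' ^^ l) (phi (2*k+1)) i + of_real (rho a (2*k)) * (U' ^^ l) (phi_star (2*k)) i)"
    using U'_pow_phi_star[of l "2*k"] by (simp del: phi_star.simps)
  finally have 1: "U (chi (2*k+1)) = \<dots>" .
  have 2: "(U' ^^ l) (phi (2*k+1)) = (\<lambda>i. of_real (rho a (2*k+1)) * chi (2*k+2) i - a (2*k+1) * chi (2*k+1) i)"
    using U'_pow_phi[OF n, of l] chi_odd[of k] chi_even[of k] Suc by (simp del: phi_star.simps funpow.simps)
  have 3: "(U' ^^ l) (phi_star (2*k)) = (\<lambda>i. cnj (ext0 a (2*k-1)) * chi (2*k) i + of_real (rho a (2*k-1)) * chi (2*k-1) i)"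
    using U'_pow_phi_star[of l "2*k-1"] chi_odd[of l] chi_even[of l] Suc by (simp del: phi_star.simps)
  show ?thesis
    unfolding 1 2 3 ..
qed

lemma add_3_4_eq_Suc: "n + 3 = Suc (Suc (Suc n))" "n + 4 = Suc (Suc (Suc (Suc n)))"
  by simp_all

text \<open>\<open>Cmat\<close> is defined by rows, whereas expanding \<open>U (chi j)\<close>
  yields columns. An even column meets the row pairs \<open>l = k\<close> and
  \<open>l = k + 1\<close>, an odd one the pairs \<open>l = k - 1\<close> and
  \<open>l = k\<close>.\<close>

lemma Cmat_even_column:
  assumes "1 \<le> n"
  shows "Cmat a n (2*k+2) = (if n = 2*k+4 then of_real (rho a (2*k+2)) * of_real (rho a (2*k+3))
    else if n = 2*k+3 then - of_real (rho a (2*k+2)) * a (2*k+3)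
    else if n = 2*k+2 then - cnj (a (2*k+1)) * a (2*k+2)
    else if n = 2*k+1 then - of_real (rho a (2*k+1)) * a (2*k+2) else 0)"
  using assms
proof (cases n rule: odd_or_even_index)
  case (1 l)
  consider "l = k" | "l = Suc k" | "l \<noteq> k" "l \<noteq> Suc k"
    by blast
  then show ?thesis
    unfolding 1 Cmat_odd_row by cases (simp_all add: ext0_pos add_3_4_eq_Suc, presburger?)
next
  case (2 l)
  consider "l = k" | "l = Suc k" | "l \<noteq> k" "l \<noteq> Suc k"
    by blast
  then show ?thesis
    unfolding 2 Cmat_even_row by cases (simp_all add: ext0_pos add_3_4_eq_Suc, presburger?)
qed

lemma Cmat_odd_column:
  assumes "1 \<le> n"
  shows "Cmat a n (2*k+1) = (if n = 2*k+2 then cnj (ext0 a (2*k)) * of_real (rho a (2*k+1))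
    else if n = 2*k+1 then - cnj (ext0 a (2*k)) * a (2*k+1)
    else if n = 2*k then of_real (rho a (2*k)) * cnj (ext0 a (2*k-1))
    else if n = 2*k-1 then of_real (rho a (2*k-1)) * of_real (rho a (2*k)) else 0)"
  using assms
proof (cases n rule: odd_or_even_index)
  case (1 l)
  consider "l = k" | "k = Suc l" | "l \<noteq> k" "k \<noteq> Suc l"
    by blast
  then show ?thesis
    unfolding 1 Cmat_odd_row by cases (simp_all add: ext0_pos add_3_4_eq_Suc, presburger?)
next
  case (2 l)
  consider "l = k" | "k = Suc l" | "l \<noteq> k" "k \<noteq> Suc l"
    by blast
  then show ?thesis
    unfolding 2 Cmat_even_row by cases (simp_all add: ext0_pos add_3_4_eq_Suc, presburger?)
qed

text \<open>Such an entry contains a factor \<open>rho\<close> at the last index, which is 0. So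
  truncating \<open>C(a)\<close> to finite order loses nothing from its columns.\<close>

lemma Cmat_outside:
  assumes "1 \<le> n" "n \<notin> idx N" and j: "j \<in> idx N"
  shows "Cmat a n j = 0"
proof -
  have nj: "j < n"
    using assms idx_down[OF j] by (meson not_le)
  show ?thesis
    using idx_ge1[OF j]
  proof (cases j rule: odd_or_even_index)
    case (1 k)
    show ?thesis
      unfolding 1 Cmat_odd_column[OF assms(1)] using nj 1 assms(2) rho_last[OF j] by auto
  next
    case (2 k)
    have "rho a (2*k+2) = 0" if "n = 2*k+3"
      using that assms(2) rho_last[OF j] 2 by (simp add: add_3_4_eq_Suc)
    \<comment> \<open>Two rows below the diagonal the last index may be \<open>2*k+2\<close> or
      \<open>2*k+3\<close>, whence the disjunction.\<close>
    moreover have "rho a (2*k+2) = 0 \<or> rho a (2*k+3) = 0" if "n = 2*k+4"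
      using that assms(2) rho_last[OF j] rho_last[of "Suc j"] 2 by (auto simp: add_3_4_eq_Suc)
    ultimately show ?thesis
      unfolding 2 Cmat_even_column[OF assms(1)] using nj 2 by auto
  qed
qed

text \<open>Only indices of actual basis vectors are kept; the rows outside \<open>idx N\<close>
  contribute nothing by \<open>Cmat_outside\<close>.\<close>

definition band :: "nat \<Rightarrow> nat set" where
  "band j = {n \<in> idx N. n \<le> j + 2 \<and> j \<le> n + 2}"

lemma finite_band: "finite (band j)"
  by (rule finite_subset[of _ "{..j + 2}"]) (auto simp: band_def)

lemma sum_band_eq:
  assumes "finite S" "\<And>n. n \<in> S \<Longrightarrow> 1 \<le> n \<and> n \<le> j + 2 \<and> j \<le> n + 2"
    and "\<And>n. n \<in> band j - S \<Longrightarrow> Cmat a n j = 0" and j: "j \<in> idx N"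
  shows "(\<Sum>n\<in>S. Cmat a n j * chi n i) = (\<Sum>n\<in>band j. Cmat a n j * chi n i)"
proof -
  have "(\<Sum>n\<in>S. Cmat a n j * chi n i) = (\<Sum>n\<in>S \<inter> band j. Cmat a n j * chi n i)"
    using assms Cmat_outside[OF _ _ j] by (intro sum.mono_neutral_right) (auto simp: band_def)
  also have "\<dots> = (\<Sum>n\<in>band j. Cmat a n j * chi n i)"
    using assms finite_band by (intro sum.mono_neutral_left) auto
  finally show ?thesis .
qed

lemma U_chi:
  assumes j: "j \<in> idx N"
  shows "U (chi j) = (\<lambda>i. \<Sum>n\<in>band j. Cmat a n j * chi n i)"
  using idx_ge1[OF j]
proof (cases j rule: odd_or_even_index)
  case (2 k)
  have "U (chi j) i = (\<Sum>n\<in>{2*k+1, 2*k+2, 2*k+3, 2*k+4}. Cmat a n j * chi n i)" for i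
    unfolding 2 U_chi_even[OF j[unfolded 2]]
    using Cmat_even_column[of "2*k+1" k] Cmat_even_column[of "2*k+2" k]
      Cmat_even_column[of "2*k+3" k] Cmat_even_column[of "2*k+4" k]
    by (simp add: algebra_simps)
  moreover have "(\<Sum>n\<in>{2*k+1, 2*k+2, 2*k+3, 2*k+4}. Cmat a n j * chi n i) =
      (\<Sum>n\<in>band j. Cmat a n j * chi n i)" for i
  proof (rule sum_band_eq[OF _ _ _ j])
    show "Cmat a n j = 0" if "n \<in> band j - {2*k+1, 2*k+2, 2*k+3, 2*k+4}" for n
      using that idx_ge1[of n] unfolding 2 by (subst Cmat_even_column) (auto simp: band_def)
  qed (auto simp: 2)
  ultimately show ?thesis
    by auto
next
  case (1 k)
  \<comment> \<open>For \<open>k = 0\<close> the expressions \<open>2*k-1\<close> and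
    \<open>2*k\<close> are both 0, which is no row index.\<close>
  define S where "S = (if k = 0 then {1, 2} else {2*k-1, 2*k, 2*k+1, 2*k+2})"
  have "U (chi j) i = (\<Sum>n\<in>S. Cmat a n j * chi n i)" for i
    unfolding 1 U_chi_odd[OF j[unfolded 1]]
    using Cmat_odd_column[of "2*k-1" k] Cmat_odd_column[of "2*k" k]
      Cmat_odd_column[of "2*k+1" k] Cmat_odd_column[of "2*k+2" k]
    by (cases k) (simp_all add: S_def algebra_simps rho_0 numeral_2_eq_2)
  moreover have "(\<Sum>n\<in>S. Cmat a n j * chi n i) = (\<Sum>n\<in>band j. Cmat a n j * chi n i)" for i
  proof (rule sum_band_eq[OF _ _ _ j])
    show "Cmat a n j = 0" if "n \<in> band j - S" for n
      using that idx_ge1[of n] unfolding 1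
      by (subst Cmat_odd_column) (auto simp: band_def S_def split: if_splits)
  qed (auto simp: 1 S_def split: if_splits)
  ultimately show ?thesis
    by auto
qed

lemma ip_U_chi:
  assumes "j \<in> idx N" "u \<in> ell2 N"
  shows "ip' u (U (chi j)) = (\<Sum>n\<in>band j. Cmat a n j * ip' u (chi n))"
  unfolding U_chi[OF assms(1)] by (rule ip_sum[OF finite_band assms(2) chi_ell2])

lemma ip_chi_U_chi:
  assumes n: "n \<in> idx N" and j: "j \<in> idx N"
  shows "ip' (chi n) (U (chi j)) = Cmat a n j"
proof -
  have "ip' (chi n) (U (chi j)) = (\<Sum>m\<in>band j. if n = m then Cmat a m j else 0)"
    unfolding ip_U_chi[OF j chi_ell2] by (intro sum.cong) (auto simp: ip_chi_chi n band_def)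
  also have "\<dots> = (if n \<in> band j then Cmat a n j else 0)"
    using finite_band by simp
  also have "\<dots> = Cmat a n j"
    using Cmat_banded[of n j] idx_ge1[OF n] n by (auto simp: band_def)
  finally show ?thesis .
qed

section \<open>Completeness of the CMV basis\<close>

lemma ip_U': "x \<in> ell2 N \<Longrightarrow> y \<in> ell2 N \<Longrightarrow> ip' y (U' x) = ip' (U y) x"
  using ip_mat_app[OF unitary_matrix_bounded(2)[OF unitary], of x y] by simp

lemma chi_1: "chi (Suc 0) = unit_vec 1" and chi_2: "chi 2 = phi 2"
  using chi_odd[of 0] chi_even[of 0] phi_star_1 by (simp_all add: numeral_2_eq_2)

text \<open>
  If \<open>y\<close> is orthogonal to all \<open>chi n\<close>, then so is \<open>U' y\<close>, because \<open>U\<close> preserves their linear span. Hence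
  the induction on the coordinate \<open>k\<close> has to range over all such \<open>y\<close>.
\<close>

lemma chi_total:
  assumes "y \<in> ell2 N" "\<And>n. n \<in> idx N \<Longrightarrow> ip' (chi n) y = 0"
  shows "y = (\<lambda>i. 0)"
proof -
  have "y k = 0" if "k \<in> idx N" "y \<in> ell2 N" "\<And>n. n \<in> idx N \<Longrightarrow> ip' (chi n) y = 0" for k y
    using that
  proof (induction k arbitrary: y rule: less_induct)
    case (less k)
    note y = less.prems(2,3)
    consider "k = 1" | m where "k = Suc m" "1 \<le> m"
      using idx_ge1[OF less.prems(1)] by (cases k) force+
    then show ?case
    proof cases
      case 1
      then show ?thesis
        using y(2)[of 1] one_idx by (simp add: chi_1 ip_unit_vec)
    next
      case (2 m)
      then have m: "m \<in> idx N" "Suc m \<in> idx N"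
        using less.prems(1) idx_down[of k N m] by auto
      have "ip' (chi n) (U' y) = 0" if n: "n \<in> idx N" for n
      proof -
        have "ip' y (U (chi n)) = 0"
          unfolding ip_U_chi[OF n y(1)] using y(2)
          by (intro sum.neutral ballI) (subst ip_commute, simp add: band_def)
        then show ?thesis
          unfolding ip_U'[OF y(1) chi_ell2] by (subst ip_commute) simp
      qed
      then have "U' y m = 0"
        using 2 m U'_ell2[OF y(1)] by (intro less.IH[of m "U' y"]) auto
      \<comment> \<open>The vanishing coordinate is this inner product, the orthogonality that
        carries the induction from \<open>m\<close> to \<open>Suc m\<close>.\<close>
      then have orth: "ip' (U (unit_vec m)) y = 0"
        unfolding ip_U'[OF y(1) unit_vec_ell2[OF m(1)], symmetric] by (simp add: ip_unit_vec m)
      have "y i = 0" if "i \<in> idx N" "i \<le> m" for i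
        by (rule less.IH[of i y]) (use that 2 y in auto)
      then show ?thesis
        unfolding 2 by (rule hessenberg_step[OF y(1) m _ orth])
    qed
  qed
  then show ?thesis
    using assms by (intro ell2_eqI[OF _ ell2_zero]) auto
qed

section \<open>The matrix \<open>V\<close>: equivalence of \<open>H\<close> with \<open>C(a)\<close>
  and recursion for the columns\<close>

definition V :: cmat where
  "V i j = cnj (chi i j)"

lemma unitary_V: "unitary_matrix N V"
  by (rule unitary_matrix_orthonormal_rows[where f = chi]) (auto simp: chi_ell2 ip_chi_chi V_def intro: chi_total)

lemma V_app: "i \<in> idx N \<Longrightarrow> mat_app N V x i = ip' (chi i) x"
  by (simp add: mat_app_def ip_def V_def)

text \<open>The conjugated rows of \<open>Cmat a\<close> are the coordinates of the vectors
  \<open>U' (chi i)\<close>, hence square-summable; this yields the boundedness of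
  \<open>Cmat a\<close> without estimates of its entries.\<close>

lemma Cmat_row:
  assumes i: "i \<in> idx N" and j: "j \<in> idx N"
  shows "mat_app N V (U' (chi i)) j = cnj (Cmat a i j)"
  using ip_chi_U_chi[OF i j] ip_commute[of N "U (chi j)" "chi i"]
  by (simp add: V_app[OF j] ip_U' chi_ell2)

lemma V_ell2: "x \<in> ell2 N \<Longrightarrow> mat_app N V x \<in> ell2 N"
  and V'_ell2: "x \<in> ell2 N \<Longrightarrow> mat_app N (mat_adj V) x \<in> ell2 N"
  by (simp_all add: unitary_matrix_ell2[OF unitary_V])

lemma V'_V: "x \<in> ell2 N \<Longrightarrow> mat_app N (mat_adj V) (mat_app N V x) = x"
  and V_V': "x \<in> ell2 N \<Longrightarrow> mat_app N V (mat_app N (mat_adj V) x) = x"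
  by (simp_all add: unitary_matrix_inverse[OF unitary_V])

text \<open>At index \<open>i\<close> both sides are the inner product of
  \<open>mat_app N V (U' (chi i))\<close> with \<open>x\<close>.\<close>

lemma Cmat_app:
  assumes x: "x \<in> ell2 N"
  shows "mat_app N (Cmat a) x = mat_app N V (U (mat_app N (mat_adj V) x))"
proof
  fix i
  show "mat_app N (Cmat a) x i = mat_app N V (U (mat_app N (mat_adj V) x)) i"
  proof (cases "i \<in> idx N")
    case True
    have "mat_app N V (U (mat_app N (mat_adj V) x)) i = ip' (U' (chi i)) (mat_app N (mat_adj V) x)"
      by (simp add: V_app True ip_U V'_ell2 x chi_ell2)
    also have "\<dots> = ip' (mat_app N V (U' (chi i))) x"
      using ip_mat_app[OF unitary_matrix_bounded(2)[OF unitary_V] x U'_ell2[OF chi_ell2]] by simp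
    also have "\<dots> = mat_app N (Cmat a) x i"
      using True by (simp add: ip_def mat_app_def[of N "Cmat a"] Cmat_row cong: infsum_cong)
    finally show ?thesis ..
  qed (simp add: mat_app_outside)
qed

lemma bounded_Cmat: "bounded_matrix N (Cmat a)"
  unfolding bounded_matrix_def
\<comment> \<open>The bound is 1 because \<open>Cmat a\<close> acts as a composition of three
  isometries.\<close>
proof (intro conjI ballI exI[of _ 1])
  fix x i assume x: "x \<in> ell2 N" and i: "i \<in> idx N"
  have "(\<lambda>j. cnj (mat_app N V (U' (chi i)) j) * x j) summable_on idx N"
    by (intro ip_summable V_ell2 U'_ell2 chi_ell2 x)
  then show "(\<lambda>j. Cmat a i j * x j) summable_on idx N"
    by (rule summable_on_cong[THEN iffD1, rotated]) (simp add: Cmat_row i)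
next
  fix x assume x: "x \<in> ell2 N"
  show "mat_app N (Cmat a) x \<in> ell2 N"
    by (simp add: Cmat_app V_ell2 U_ell2 V'_ell2 x)
  show "ell2_norm N (mat_app N (Cmat a) x) \<le> 1 * ell2_norm N x"
    by (simp add: Cmat_app V_ell2 U_ell2 V'_ell2 x unitary_matrix_norm[OF unitary_V]
        unitary_matrix_norm[OF unitary] unitary_matrix_norm[OF unitary_matrix_mat_adj[OF unitary_V]])
qed

lemma V_U: "x \<in> ell2 N \<Longrightarrow> mat_app N V (U x) = mat_app N (Cmat a) (mat_app N V x)"
  by (simp add: Cmat_app V_ell2 V'_V)

lemma unitarily_equivalent_V: "unitarily_equivalent_via N V H (Cmat a)"
  unfolding unitarily_equivalent_via_def
  using unitary_matrix_bounded(1)[OF unitary] bounded_Cmat unitary_V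
  by (simp add: V_U[symmetric] V'_V U_ell2)

text \<open>The powers in \<open>chi i\<close> are moved onto \<open>unit_vec j\<close>, which stays
  of low enough degree for \<open>chi_base_orth\<close>. The entry \<open>i = j = 1\<close> also
  satisfies the inequality but equals 1, so it is excluded.\<close>

lemma V_zero:
  assumes i: "i \<in> idx N" and j: "j \<in> idx N" and "2 * j \<le> Suc i" "i \<noteq> 1 \<or> j \<noteq> 1"
  shows "V i j = 0"
proof -
  have ej: "unit_vec j \<in> polys j"
    by (simp add: polys_def unit_vec_ell2[OF j]) (simp add: unit_vec_def)
  have "ip' (chi i) (unit_vec j) = 0"
    using idx_ge1[OF i]
  proof (cases i rule: odd_or_even_index)
    case (1 k)
    then obtain l where l: "k = Suc l"
      using assms(3,4) idx_ge1[OF j] by (cases k) auto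
    have "ip' (chi_base i) (U ((U ^^ l) (unit_vec j))) = 0"
      using chi_base_orth(1)[OF i U_pow_polys[OF ej, of l]] 1 l assms(3) by simp
    then show ?thesis
      using 1 l by (simp add: ip_chi unit_vec_ell2 j)
  next
    case (2 k)
    then have "ip' (chi_base i) ((U ^^ k) (unit_vec j)) = 0"
      using chi_base_orth(2)[OF i U_pow_polys[OF ej, of k]] assms(3) by simp
    then show ?thesis
      using 2 by (simp add: ip_chi unit_vec_ell2 j)
  qed
  then show ?thesis
    by (simp add: V_def ip_unit_vec_right[OF j])
qed

lemma V_first_columns:
  assumes i: "i \<in> idx N" and j: "j \<in> idx N" "j \<le> 2"
  shows "V i j = cnj (phase j) * (if i = j then 1 else 0)"
proof -
  consider "i = 1" | "i = 2" | "i > 2"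
    using idx_ge1[OF i] by linarith
  then show ?thesis
  proof cases
    case 1
    then show ?thesis
      by (auto simp: V_def chi_1 unit_vec_def phase_1)
  next
    case 2
    then show ?thesis
      using i by (auto simp: V_def chi_2 phi_def)
  next
    case 3
    then show ?thesis
      using V_zero[OF i j(1)] j(2) by simp
  qed
qed

text \<open>This is entry \<open>(i, m)\<close> of \<open>V H = C V\<close> with the subdiagonal
  entry of \<open>H\<close> isolated. The ranges of summation come from the Hessenberg form of
  \<open>H\<close>, the band of \<open>C\<close> and the zeros of \<open>V\<close>.\<close>

lemma V_step:
  assumes i: "i \<in> idx N" and m: "2 \<le> m" "m \<in> idx N" "Suc m \<in> idx N"
  shows "H (Suc m) m * V i (Suc m) =
    (\<Sum>k | k \<in> idx N \<and> i \<le> k + 2 \<and> k \<le> min (i + 2) (2 * m - 2). Cmat a i k * V k m) -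
    (\<Sum>k | k \<in> idx N \<and> min i ((i + 3) div 2) \<le> k \<and> k \<le> m. H k m * V i k)"
    (is "_ = sum _ ?S - sum _ ?T")
proof -
  have finS: "finite ?S"
    by (rule finite_subset[of _ "{..i + 2}"]) auto
  have finT: "finite ?T"
    by (rule finite_subset[of _ "{..m}"]) auto
  have "((\<lambda>k. V i k * U (unit_vec m) k) has_sum (\<Sum>k\<in>insert (Suc m) ?T. H k m * V i k)) (idx N)"
  proof (rule has_sum_finite_neutralI)
    fix k assume k: "k \<in> idx N - insert (Suc m) ?T"
    show "V i k * U (unit_vec m) k = 0"
    proof (cases "Suc m < k")
      case True
      then show ?thesis
        using below_subdiag[of k m] k m by (simp add: mat_app_unit_vec)
    next
      case False
      \<comment> \<open>\<open>k < (i + 3) div 2\<close> means \<open>2 * k \<le> i + 1\<close>, as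
        in \<open>V_zero\<close>; \<open>k < i\<close> rules out the exceptional entry
        \<open>V 1 1\<close>.\<close>
      then have "k < i" "k < (i + 3) div 2"
        using k by auto
      then have "V i k = 0"
        using k i by (intro V_zero) auto
      then show ?thesis
        by simp
    qed
  qed (use finT m in \<open>auto simp: mat_app_unit_vec mult.commute intro!: sum.cong\<close>)
  then have "mat_app N V (U (unit_vec m)) i = (\<Sum>k\<in>insert (Suc m) ?T. H k m * V i k)"
    using i by (simp only: mat_app_def[of N V] infsumI if_True)
  also have "\<dots> = H (Suc m) m * V i (Suc m) + (\<Sum>k\<in>?T. H k m * V i k)"
    using finT by simp
  finally have lhs: "mat_app N V (U (unit_vec m)) i = \<dots>" .
  have "((\<lambda>k. Cmat a i k * mat_app N V (unit_vec m) k) has_sum (\<Sum>k\<in>?S. Cmat a i k * V k m)) (idx N)"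
  proof (rule has_sum_finite_neutralI)
    fix k assume k: "k \<in> idx N - ?S"
    show "Cmat a i k * mat_app N V (unit_vec m) k = 0"
    proof (cases "2 * m - 2 < k")
      case True
      then have "V k m = 0"
        using k m by (intro V_zero) auto
      then show ?thesis
        by (simp add: mat_app_unit_vec m)
    next
      case False
      then have "Cmat a i k = 0"
        using k idx_ge1[OF i] by (intro Cmat_banded) auto
      then show ?thesis
        by simp
    qed
  qed (use finS m in \<open>auto simp: mat_app_unit_vec intro!: sum.cong\<close>)
  then have "mat_app N (Cmat a) (mat_app N V (unit_vec m)) i = (\<Sum>k\<in>?S. Cmat a i k * V k m)"
    using i by (simp only: mat_app_def[of N "Cmat a"] infsumI if_True)
  with lhs show ?thesis
    using V_U[OF unit_vec_ell2[OF m(2)]] by (simp add: algebra_simps)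
qed

lemma V_recursion_V: "V_recursion N H (Cmat a) V"
  unfolding V_recursion_def
proof (intro ballI)
  fix i j assume i: "i \<in> idx N" and j: "j \<in> idx N"
  consider "j \<le> 2" | "2 < j" "2 * j - 2 < i" | "2 < j" "i \<le> 2 * j - 2"
    by linarith
  then show "V i j = (if j \<le> 2 then
             cnj (tau H j) / of_real (cmod (tau H j)) * (if i = j then 1 else 0)
           else if i \<le> 2*j - 2 then
             1 / H j (j-1) *
               ((\<Sum>k | k \<in> idx N \<and> i \<le> k + 2 \<and> k \<le> min (i+2) (2*j-4). Cmat a i k * V k (j-1)) -
                (\<Sum>k | k \<in> idx N \<and> min i ((i+3) div 2) \<le> k \<and> k \<le> j-1. H k (j-1) * V i k))
           else 0)"
  proof cases
    case 1
    then show ?thesis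
      using V_first_columns[OF i j] by (simp add: phase_def)
  next
    case 2
    then show ?thesis
      using V_zero[OF i j] by simp
  next
    \<comment> \<open>With \<open>m = j - 1\<close> the bound \<open>2 * m - 2\<close> of
      \<open>V_step\<close> becomes \<open>2 * j - 4\<close>.\<close>
    case 3
    then obtain m where m: "j = Suc m" "2 \<le> m"
      by (cases j) auto
    then have mi: "m \<in> idx N" "Suc m \<in> idx N"
      using j idx_down[OF j, of m] by auto
    show ?thesis
      using 3 V_step[OF i m(2) mi] subdiag[OF mi] m by (simp add: field_simps)
  qed
qed

subsection \<open>Eigenvectors\<close>

lemma eigenvalue_cmod:
  assumes "eigenvector N H z x"
  shows "cmod z = 1"
proof -
  have x: "x \<in> ell2 N" "x \<noteq> (\<lambda>i. 0)" "U x = (\<lambda>i. z * x i)"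
    using assms by (auto simp: eigenvector_def)
  have "ell2_norm N x = cmod z * ell2_norm N x"
    using unitary_matrix_norm[OF unitary x(1)] by (simp add: x(3) ell2_norm_scale)
  moreover have "ell2_norm N x \<noteq> 0"
  proof
    assume "ell2_norm N x = 0"
    then have "x i = 0" if "i \<in> idx N" for i
      using cmod_le_ell2_norm[OF x(1) that] by simp
    then show False
      using x(2) ell2_eqI[OF x(1) ell2_zero] by blast
  qed
  ultimately show ?thesis
    by simp
qed

lemma eigenvalue_cnj: "eigenvector N H z x \<Longrightarrow> z * cnj z = 1"
  using complex_norm_square[of z] by (simp add: eigenvalue_cmod)

lemma U'_eigenvector:
  assumes "eigenvector N H z x"
  shows "U' x = (\<lambda>i. cnj z * x i)"
proof -
  have x: "x \<in> ell2 N" "U x = (\<lambda>i. z * x i)"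
    using assms by (auto simp: eigenvector_def)
  have "x = (\<lambda>i. z * U' x i)"
    using U'_U[OF x(1)] by (simp add: x(2) mat_app_scale)
  then have "(\<lambda>i. cnj z * x i) = (\<lambda>i. cnj z * (z * U' x i))"
    by metis
  then show ?thesis
    using eigenvalue_cnj[OF assms] by (simp add: mult.assoc[symmetric] mult.commute[of "cnj z"])
qed

lemma ip_U_eigenvector:
  assumes "eigenvector N H z x" "u \<in> ell2 N"
  shows "ip' (U u) x = cnj z * ip' u x"
proof -
  have "x \<in> ell2 N"
    using assms(1) by (simp add: eigenvector_def)
  then show ?thesis
    using ip_U'[of x u] assms(2) by (simp add: U'_eigenvector[OF assms(1)] ip_scale)
qed

text \<open>For an eigenvector \<open>ip' (U (unit_vec k)) x\<close> is a multiple of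
  \<open>x k\<close>, so a vanishing first entry would propagate to all entries.\<close>

lemma eigenvector_first_nonzero:
  assumes "eigenvector N H z x"
  shows "x 1 \<noteq> 0"
proof
  assume "x 1 = 0"
  have x: "x \<in> ell2 N" "x \<noteq> (\<lambda>i. 0)"
    using assms by (auto simp: eigenvector_def)
  have "x = (\<lambda>i. 0)"
    by (rule hessenberg_zeroI[where u = x, OF x(1) \<open>x 1 = 0\<close>])
      (simp add: ip_U_eigenvector[OF assms] unit_vec_ell2 ip_unit_vec)
  then show False
    using x(2) by blast
qed

lemma eigenvector_unique:
  assumes "eigenvector N H z x" "eigenvector N H z x'" "x 1 = x' 1"
  shows "x = x'"
proof (rule ccontr)
  assume "x \<noteq> x'"
  then have "(\<lambda>i. x i - x' i) \<noteq> (\<lambda>i. 0)"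
    by (metis eq_iff_diff_eq_0 ext)
  moreover have "U (\<lambda>i. x i - x' i) = (\<lambda>i. z * (x i - x' i))"
    using assms by (simp add: eigenvector_def mat_app_diff[OF unitary_matrix_bounded(1)[OF unitary]]
        right_diff_distrib)
  ultimately have "eigenvector N H z (\<lambda>i. x i - x' i)"
    using assms by (auto simp: eigenvector_def ell2_diff)
  from eigenvector_first_nonzero[OF this] show False
    using assms(3) by simp
qed

text \<open>The adjoint of \<open>V\<close> intertwines \<open>Cmat a\<close> with \<open>H\<close>,
  and it keeps the first entry because \<open>chi 1\<close> is \<open>unit_vec 1\<close>.\<close>

lemma Cmat_eigenvector:
  assumes "eigenvector N (Cmat a) z y"
  shows "eigenvector N H z (mat_app N (mat_adj V) y)" and "mat_app N (mat_adj V) y 1 = y 1"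
proof -
  have y: "y \<in> ell2 N" "y \<noteq> (\<lambda>i. 0)" "mat_app N (Cmat a) y = (\<lambda>i. z * y i)"
    using assms by (auto simp: eigenvector_def)
  have "U (mat_app N (mat_adj V) y) = (\<lambda>i. z * mat_app N (mat_adj V) y i)"
    using V'_V[OF U_ell2[OF V'_ell2[OF y(1)]]]
    unfolding Cmat_app[OF y(1), symmetric] y(3) by (simp add: mat_app_scale)
  moreover have "mat_app N (mat_adj V) y \<noteq> (\<lambda>i. 0)"
    using V_V'[OF y(1)] y(2) mat_app_zero by metis
  ultimately show "eigenvector N H z (mat_app N (mat_adj V) y)"
    using V'_ell2[OF y(1)] by (simp add: eigenvector_def)
  have "mat_app N V (mat_app N (mat_adj V) y) 1 = mat_app N (mat_adj V) y 1"
    using one_idx by (simp add: V_app chi_1 ip_unit_vec)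
  then show "mat_app N (mat_adj V) y 1 = y 1"
    by (simp add: V_V' y(1))
qed

lemma Cmat_eigenvector_first_nonzero:
  "eigenvector N (Cmat a) z y \<Longrightarrow> y 1 \<noteq> 0"
  using Cmat_eigenvector eigenvector_first_nonzero by metis

text \<open>The inner product of p(U) e_1 with \<open>x\<close> is the conjugate of p(z) times
  \<open>x 1\<close>, so this is the reversal identity between the polynomials on the unit circle. A
  real \<open>x 1\<close> passes unchanged through the conjugation.\<close>

lemma ip_phi_star_eigenvector:
  assumes x: "eigenvector N H z x" "x 1 \<in> \<real>"
  shows "n \<in> idx N \<Longrightarrow> ip' (phi_star n) x = cnj z ^ (n - 1) * cnj (ip' (phi n) x)"
proof (induction n)
  case (Suc n)
  have xl: "x \<in> ell2 N"
    using x(1) by (simp add: eigenvector_def)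
  show ?case
  proof (cases "n = 0")
    case True
    then show ?thesis
      unfolding True phi_star_1 phi_1 using x(2) ip_unit_vec[OF one_idx(1), of x]
      by (simp add: Reals_cnj_iff)
  next
    case False
    then have n1: "1 \<le> n" and n: "n \<in> idx N"
      using idx_down[OF Suc.prems, of n] by simp_all
    define p q p' w v where "p = ip' (phi n) x" and "q = ip' (phi_star n) x" and "p' = ip' (phi (Suc n)) x"
      and "w = cnj z ^ n" and "v = cnj z ^ (n - 1)"
    define r where "r = complex_of_real (rho a n)"
    have zz: "z * cnj z = 1"
      by (rule eigenvalue_cnj[OF x(1)])
    have vv: "v * cnj v = 1"
      using zz by (simp add: v_def power_mult_distrib[symmetric] mult.commute)
    have w: "w = cnj z * v"
      using n1 by (simp add: w_def v_def power_eq_if)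
    have q: "q = v * cnj p"
      unfolding q_def v_def p_def by (rule Suc.IH[OF n])
    \<comment> \<open>\<open>r\<close> can be divided by because \<open>Suc n\<close> still is an
      index.\<close>
    have r0: "r \<noteq> 0"
      using subdiag[OF n Suc.prems] Suc.prems by (simp add: r_def rho_eq[OF n])
    have "a n * cnj (a n) + r * r = complex_of_real ((cmod (a n))\<^sup>2 + (rho a n)\<^sup>2)"
      unfolding of_real_add complex_norm_square by (simp add: r_def power2_eq_square)
    then have rr: "r * r = 1 - a n * cnj (a n)"
      unfolding cmod_a_rho[OF n] by (simp add: eq_diff_eq add.commute)
    have 1: "cnj z * p = r * p' - cnj (a n) * q"
      using ip_U_eigenvector[OF x(1) phi_ell2[of n]]
      unfolding U_phi[OF n] ip_lincomb_left[OF xl phi_ell2 phi_star_ell2]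
      by (simp add: p_def q_def p'_def r_def)
    \<comment> \<open>The recursion \<open>1\<close> is used once as it stands and once conjugated;
      eliminating \<open>p\<close> leaves an expression of \<open>q\<close> by \<open>p'\<close>
      alone.\<close>
    have "w * cnj q = (v * cnj v) * (cnj z * p)"
      by (simp add: w q mult_ac)
    then have 2: "w * cnj q = r * p' - cnj (a n) * q"
      by (simp add: vv 1)
    have "q = (z * cnj z) * (v * cnj p)"
      by (simp add: zz q)
    also have "\<dots> = w * cnj (cnj z * p)"
      by (simp add: w mult_ac)
    also have "\<dots> = r * (w * cnj p') - a n * (w * cnj q)"
      unfolding 1 by (simp add: r_def algebra_simps)
    finally have "r * (r * q) = r * (w * cnj p' - a n * p')"
      unfolding 2 mult.assoc[symmetric] rr by (simp add: algebra_simps)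
    then have 3: "r * q = w * cnj p' - a n * p'"
      using r0 by simp
    have "ip' (phi_star (Suc n)) x = a n * p' + r * q"
      unfolding phi_star.simps ip_lincomb_left[OF xl phi_ell2 phi_star_ell2]
      by (simp add: p'_def q_def r_def ext0_pos[OF n1])
    also have "\<dots> = w * cnj p'"
      by (simp add: 3)
    finally show ?thesis
      by (simp add: w_def p'_def)
  qed
qed (simp add: idx_def)

lemma U_pow_eigenvector:
  assumes "eigenvector N H z x"
  shows "(U ^^ k) x = (\<lambda>i. z ^ k * x i)"
  using assms by (induction k) (simp_all add: eigenvector_def mat_app_scale mult.assoc mult.left_commute)

text \<open>By uniqueness \<open>x\<close> is the adjoint of \<open>V\<close> applied to
  \<open>y\<close>, so \<open>y n\<close> is \<open>ip' (chi n) x\<close>, a power of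
  \<open>z\<close> times \<open>ip' (chi_base n) x\<close>. For even \<open>n\<close> this is a
  multiple of \<open>x n\<close>; for odd \<open>n\<close> the reversal identity makes it a multiple
  of the conjugate of \<open>x n\<close>.\<close>

lemma eigenvector_relation:
  assumes x: "eigenvector N H z x" and y: "eigenvector N (Cmat a) z y"
    and xy: "x 1 = y 1" "y 1 \<in> \<real>" and "1 \<le> k"
  shows "2*k - 1 \<in> idx N \<Longrightarrow> x (2*k - 1) = phase (2*k - 1) * z powi (1 - int k) * cnj (y (2*k - 1))"
    and "2*k \<in> idx N \<Longrightarrow> x (2*k) = phase (2*k) * z powi (1 - int k) * y (2*k)"
proof -
  obtain l where k: "k = Suc l"
    using \<open>1 \<le> k\<close> by (cases k) auto
  have xl: "x \<in> ell2 N" and yl: "y \<in> ell2 N"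
    using x y by (auto simp: eigenvector_def)
  have zz: "z * cnj z = 1"
    by (rule eigenvalue_cnj[OF x])
  have z0: "z \<noteq> 0"
    using zz by auto
  have zi: "inverse z = cnj z"
    using zz z0 by (simp add: field_simps)
  have powi: "z powi (1 - int k) = cnj z ^ l"
    by (simp add: k power_int_minus zi flip: power_inverse)
  have pow: "cnj z ^ l * z ^ l = 1"
    using zz by (simp add: power_mult_distrib[symmetric] mult.commute)
  have "x = mat_app N (mat_adj V) y"
    using Cmat_eigenvector[OF y] xy(1) by (intro eigenvector_unique[OF x]) simp_all
  then have "mat_app N V x = y"
    by (simp add: V_V' yl)
  then have yn: "y n = z ^ ((n - 1) div 2) * ip' (chi_base n) x" if "n \<in> idx N" for n
    using V_app[OF that, of x] by (simp add: ip_chi xl U_pow_eigenvector[OF x] ip_scale)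
  show "x (2*k - 1) = phase (2*k - 1) * z powi (1 - int k) * cnj (y (2*k - 1))"
    if n: "2*k - 1 \<in> idx N"
  proof -
    have n': "2*l+1 \<in> idx N"
      using n by (simp add: k)
    have x1: "x 1 \<in> \<real>"
      using xy by simp
    have "y (2*l+1) = z ^ l * (cnj z ^ (2*l) * cnj (cnj (phase (2*l+1)) * x (2*l+1)))"
      using yn[OF n'] ip_phi_star_eigenvector[OF x x1 n', unfolded ip_phi[OF n']]
      by (simp add: chi_base_def del: phi_star.simps)
    also have "cnj z ^ (2*l) = cnj z ^ l * cnj z ^ l"
      by (simp add: mult_2 power_add)
    finally have "y (2*l+1) = (cnj z ^ l * z ^ l) * (cnj z ^ l * phase (2*l+1) * cnj (x (2*l+1)))"
      by (simp add: mult_ac)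
    then have "y (2*l+1) = cnj z ^ l * phase (2*l+1) * cnj (x (2*l+1))"
      unfolding pow by simp
    then have "cnj (y (2*l+1)) = z ^ l * (cnj (phase (2*l+1)) * x (2*l+1))"
      by simp
    then have "phase (2*l+1) * cnj z ^ l * cnj (y (2*l+1)) =
        (cnj z ^ l * z ^ l) * (phase (2*l+1) * cnj (phase (2*l+1))) * x (2*l+1)"
      by (simp add: mult_ac)
    then show ?thesis
      unfolding powi pow phase_cnj[OF n'] by (simp add: k)
  qed
  show "x (2*k) = phase (2*k) * z powi (1 - int k) * y (2*k)" if n: "2*k \<in> idx N"
  proof -
    have "y (2*k) = z ^ l * (cnj (phase (2*k)) * x (2*k))"
      using yn[OF n] ip_phi[OF n] by (simp add: chi_base_def k)
    then have "phase (2*k) * cnj z ^ l * y (2*k) =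
        (cnj z ^ l * z ^ l) * (phase (2*k) * cnj (phase (2*k))) * x (2*k)"
      by (simp add: mult_ac)
    then show ?thesis
      unfolding powi pow phase_cnj[OF n] by simp
  qed
qed

end

text \<open>A common non-real factor of \<open>x\<close> and \<open>y\<close> would destroy the odd
  relation, which conjugates \<open>y\<close>; hence the normalisation by a common real first entry.
  Since first entries do not vanish, every eigenvector can be scaled to satisfy it.\<close>

theorem theorem3p8:
  fixes N :: enat and H C :: cmat and a :: cvec
  assumes "N \<noteq> 0"
    and "unitary_matrix N H"
    and "irreducible_hessenberg N H"
    and "\<And>n. n \<in> idx N \<Longrightarrow> a n = - H 1 n / cnj (tau H n)"
    and "C = Cmat a"
  shows "(\<forall>n\<in>idx N. cmod (a n) \<le> 1) \<and>
    para_tridiagonal N C \<and>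
    (\<exists>V. V_recursion N H C V \<and> unitarily_equivalent_via N V H C) \<and>
    (\<forall>z x. eigenvector N H z x \<longrightarrow> x 1 \<noteq> 0) \<and>
    (\<forall>z y. eigenvector N C z y \<longrightarrow> y 1 \<noteq> 0) \<and>
    (\<forall>z x y. eigenvector N H z x \<and> eigenvector N C z y \<and> x 1 = y 1 \<and> y 1 \<in> \<real> \<longrightarrow>
       (\<forall>k\<ge>1.
          (2*k - 1 \<in> idx N \<longrightarrow>
             x (2*k - 1) = tau H (2*k - 1) / of_real (cmod (tau H (2*k - 1)))
                             * z powi (1 - int k) * cnj (y (2*k - 1))) \<and>
          (2*k \<in> idx N \<longrightarrow>
             x (2*k) = tau H (2*k) / of_real (cmod (tau H (2*k)))
                         * z powi (1 - int k) * y (2*k))))"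
proof -
  interpret unitary_hessenberg N H a
    using assms(1-4) by unfold_locales
  show ?thesis
    unfolding \<open>C = Cmat a\<close>
    using cmod_a_le_1 para_tridiagonal_Cmat V_recursion_V unitarily_equivalent_V
      eigenvector_first_nonzero Cmat_eigenvector_first_nonzero eigenvector_relation[unfolded phase_def]
    by blast
qed

end
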